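(* There exists a category $\mathsf{C}$ equipped with a system of bicoverings for which the category $\mathsf{Gl}(\mathsf{C},\mathbf{Set})$ of $\mathbf{Set}$-valued gleaves on $\mathsf{C}$ is not cartesian closed, but does have a subobject classifier.
   Context: **Systems of bicoverings.** A system of bicoverings on a category $\mathsf{C}$ is a collection of cospans $a\to c\leftarrow b$, called bicoverings (the two legs are not distinguished: swapping them gives the same cospan), such that: 1. both legs of a bicovering are monomorphisms; 2. every bicovering can be completed to a pullback square; 3. for every object $a$, the cospan $a=a=a$ (both legs $\mathrm{id}_a$) is a bicovering; 4. if $a\to c\leftarrow b$ and $a'\to a\leftarrow a\times_c b$ are bicoverings, then so is the composed cospan $a'\to c\leftarrow b$; 5. if $a\to c\leftarrow b$ is a bicovering, $f:c'\to c$ is a morphism, and the pullbacks $f^*(a)\to c'$ and $f^*(b)\to c'$ of the two legs along $f$ exist, then $f^*(a)\to c'\leftarrow f^*(b)$ is a bicovering. A morphism of bicoverings from $a'\to c'\leftarrow b'$ to $a\to c\leftarrow b$ consists of $q_a:a'\to a$, $q_b:b'\to b$, $q_c:c'\to c$ commuting with the legs, such that the induced map $a'\times_{c'}b'\to a\times_c b$ has a right inverse. **Gleaves.** A $\mathbf{Set}$-valued gleaf on $\mathsf{C}$ is a functor $\Gamma:\mathsf{C}^{\mathrm{op}}\to\mathbf{Set}$ together with a map $g:\Gamma(a)\times_{\Gamma(a\times_c b)}\Gamma(b)\to\Gamma(c)$ for every bicovering $a\to c\leftarrow b$ (independent, up to swapping arguments, of the order of the legs), such that: 1. (Identity) for a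 bicovering $a=a\leftarrow b$, $g=\pi_1:\Gamma(a)\times_{\Gamma(b)}\Gamma(b)\to\Gamma(a)$; for a bicovering $a\to b=b$, $g=\pi_2:\Gamma(a)\times_{\Gamma(a)}\Gamma(b)\to\Gamma(b)$. 2. (Back-and-forth) given bicoverings $a\to c\leftarrow b$ and $a'\to a\leftarrow a\times_c b$, the composite $\Gamma(a')\times_{\Gamma(a'\times_c b)}\Gamma(b)\xrightarrow{g}\Gamma(c)\to\Gamma(a)\times_{\Gamma(a\times_c b)}\Gamma(b)\xrightarrow{g}\Gamma(c)$ (middle arrow: restriction) equals $g:\Gamma(a')\times_{\Gamma(a'\times_c b)}\Gamma(b)\to\Gamma(c)$. 3. (Partial naturality) for every morphism of bicoverings $(q_a,q_b,q_c)$ from $a'\to c'\leftarrow b'$ to $a\to c\leftarrow b$, $\Gamma(q_c)\circ g=g\circ(\Gamma(q_a)\times\Gamma(q_b))$ as maps $\Gamma(a)\times_{\Gamma(a\times_c b)}\Gamma(b)\to\Gamma(c')$. A morphism of gleaves $(\Gamma,g)\to(\Gamma',g')$ is a natural transformation $f:\Gamma\to\Gamma'$ such that $f_c\circ g=g'\circ(f_a\times f_b)$ on $\Gamma(a)\times_{\Gamma(a\times_c b)}\Gamma(b)$ for every bicovering $a\to c\leftarrow b$. These form the category $\mathsf{Gl}(\mathsf{C},\mathbf{Set})$. *)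

theory Defs
  imports Main "HOL-Library.FuncSet" "HOL-Library.Equipollence"
begin

section \<open>Categories\<close>

record ('o, 'a) cat =
  Ob :: "'o set"
  Arr :: "'a set"
  Dom :: "'a \<Rightarrow> 'o"
  Cod :: "'a \<Rightarrow> 'o"
  Idt :: "'o \<Rightarrow> 'a"
  Comp :: "'a \<Rightarrow> 'a \<Rightarrow> 'a"

definition hom :: "('o, 'a, 'z) cat_scheme \<Rightarrow> 'o \<Rightarrow> 'o \<Rightarrow> 'a set" where
  "hom C a b = {f \<in> Arr C. Dom C f = a \<and> Cod C f = b}"

text \<open>\<open>Comp C g f\<close> is the composite \<open>g \<circ> f\<close>; it is meaningful only when \<open>Cod C f = Dom C g\<close>.\<close>

locale category =
  fixes C :: "('o, 'a, 'z) cat_scheme"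
  assumes Dom_Ob: "f \<in> Arr C \<Longrightarrow> Dom C f \<in> Ob C"
    and Cod_Ob: "f \<in> Arr C \<Longrightarrow> Cod C f \<in> Ob C"
    and Idt_hom: "a \<in> Ob C \<Longrightarrow> Idt C a \<in> hom C a a"
    and Comp_hom: "f \<in> hom C a b \<Longrightarrow> g \<in> hom C b c \<Longrightarrow> Comp C g f \<in> hom C a c"
    and Comp_Idt_left: "f \<in> hom C a b \<Longrightarrow> Comp C (Idt C b) f = f"
    and Comp_Idt_right: "f \<in> hom C a b \<Longrightarrow> Comp C f (Idt C a) = f"
    and Comp_assoc: "f \<in> hom C a b \<Longrightarrow> g \<in> hom C b c \<Longrightarrow> h \<in> hom C c d \<Longrightarrow>
          Comp C h (Comp C g f) = Comp C (Comp C h g) f"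

definition monic :: "('o, 'a, 'z) cat_scheme \<Rightarrow> 'a \<Rightarrow> bool" where
  "monic C m \<longleftrightarrow> m \<in> Arr C \<and>
     (\<forall>a\<in>Ob C. \<forall>f\<in>hom C a (Dom C m). \<forall>g\<in>hom C a (Dom C m).
        Comp C m f = Comp C m g \<longrightarrow> f = g)"

definition has_right_inverse :: "('o, 'a, 'z) cat_scheme \<Rightarrow> 'a \<Rightarrow> bool" where
  "has_right_inverse C u \<longleftrightarrow> u \<in> Arr C \<and>
     (\<exists>s\<in>hom C (Cod C u) (Dom C u). Comp C u s = Idt C (Cod C u))"

text \<open>\<open>is_pullback C f g p q\<close>: the square \<open>f \<circ> p = g \<circ> q\<close> is a pullback of the cospan \<open>(f, g)\<close>.\<close>

definition is_pullback :: "('o, 'a, 'z) cat_scheme \<Rightarrow> 'a \<Rightarrow> 'a \<Rightarrow> 'a \<Rightarrow> 'a \<Rightarrow> bool" where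
  "is_pullback C f g p q \<longleftrightarrow>
     f \<in> Arr C \<and> g \<in> Arr C \<and> Cod C f = Cod C g \<and>
     p \<in> hom C (Dom C p) (Dom C f) \<and> q \<in> hom C (Dom C p) (Dom C g) \<and>
     Comp C f p = Comp C g q \<and>
     (\<forall>t\<in>Ob C. \<forall>r\<in>hom C t (Dom C f). \<forall>s\<in>hom C t (Dom C g).
        Comp C f r = Comp C g s \<longrightarrow>
        (\<exists>!u. u \<in> hom C t (Dom C p) \<and> Comp C p u = r \<and> Comp C q u = s))"

definition is_terminal :: "('o, 'a, 'z) cat_scheme \<Rightarrow> 'o \<Rightarrow> bool" where
  "is_terminal C t \<longleftrightarrow> t \<in> Ob C \<and> (\<forall>a\<in>Ob C. \<exists>!f. f \<in> hom C a t)"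

definition is_product :: "('o, 'a, 'z) cat_scheme \<Rightarrow> 'o \<Rightarrow> 'o \<Rightarrow> 'o \<Rightarrow> 'a \<Rightarrow> 'a \<Rightarrow> bool" where
  "is_product C a b d p q \<longleftrightarrow>
     d \<in> Ob C \<and> p \<in> hom C d a \<and> q \<in> hom C d b \<and>
     (\<forall>t\<in>Ob C. \<forall>r\<in>hom C t a. \<forall>s\<in>hom C t b.
        \<exists>!u. u \<in> hom C t d \<and> Comp C p u = r \<and> Comp C q u = s)"

text \<open>
  \<open>ev : e \<times> b \<rightarrow> c\<close> exhibits \<open>e\<close> as the exponential of \<open>c\<close> by \<open>b\<close>. In the universal property,
  \<open>w\<close> is the arrow \<open>h \<times> b : a \<times> b \<rightarrow> e \<times> b\<close>.
\<close>

definition is_exponential :: "('o, 'a, 'z) cat_scheme \<Rightarrow> 'o \<Rightarrow> 'o \<Rightarrow> 'o \<Rightarrow> 'a \<Rightarrow> bool" where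
  "is_exponential C b c e ev \<longleftrightarrow>
     (\<exists>d p q. is_product C e b d p q \<and> ev \<in> hom C d c \<and>
        (\<forall>a d' p' q' f. is_product C a b d' p' q' \<and> a \<in> Ob C \<and> f \<in> hom C d' c \<longrightarrow>
           (\<exists>!h. h \<in> hom C a e \<and>
              (\<exists>w\<in>hom C d' d. Comp C p w = Comp C h p' \<and> Comp C q w = q' \<and> Comp C ev w = f))))"

definition cartesian_closed :: "('o, 'a, 'z) cat_scheme \<Rightarrow> bool" where
  "cartesian_closed C \<longleftrightarrow>
     (\<exists>t. is_terminal C t) \<and>
     (\<forall>a\<in>Ob C. \<forall>b\<in>Ob C. \<exists>d p q. is_product C a b d p q) \<and>
     (\<forall>b\<in>Ob C. \<forall>c\<in>Ob C. \<exists>e\<in>Ob C. \<exists>ev. is_exponential C b c e ev)"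

definition is_subobject_classifier :: "('o, 'a, 'z) cat_scheme \<Rightarrow> 'o \<Rightarrow> 'o \<Rightarrow> 'a \<Rightarrow> bool" where
  "is_subobject_classifier C t \<Omega> tr \<longleftrightarrow>
     is_terminal C t \<and> \<Omega> \<in> Ob C \<and> tr \<in> hom C t \<Omega> \<and>
     (\<forall>m. monic C m \<longrightarrow>
        (\<exists>!\<chi>. \<chi> \<in> hom C (Cod C m) \<Omega> \<and> (\<exists>k. is_pullback C \<chi> tr m k)))"

definition has_subobject_classifier :: "('o, 'a, 'z) cat_scheme \<Rightarrow> bool" where
  "has_subobject_classifier C \<longleftrightarrow> (\<exists>t \<Omega> tr. is_subobject_classifier C t \<Omega> tr)"

section \<open>Systems of bicoverings\<close>

text \<open>
  A cospan \<open>a \<rightarrow> c \<leftarrow> b\<close> is the pair of its legs. The legs are not distinguished, so a collection of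
  cospans is a symmetric set of pairs. Pullbacks are never chosen: the axioms are imposed for
  every pullback square.
\<close>

locale bicovering_system = category C
  for C :: "('o, 'a, 'z) cat_scheme" +
  fixes B :: "('a \<times> 'a) set"
  assumes cospan: "(m, n) \<in> B \<Longrightarrow> m \<in> Arr C \<and> n \<in> Arr C \<and> Cod C m = Cod C n"
    and swap: "(m, n) \<in> B \<Longrightarrow> (n, m) \<in> B"
    and legs_monic: "(m, n) \<in> B \<Longrightarrow> monic C m \<and> monic C n"
    and pullback_exists: "(m, n) \<in> B \<Longrightarrow> \<exists>p q. is_pullback C m n p q"
    and Idt_bicovering: "a \<in> Ob C \<Longrightarrow> (Idt C a, Idt C a) \<in> B"
    and Comp_bicovering: "(m, n) \<in> B \<Longrightarrow> is_pullback C m n p q \<Longrightarrow> (k, p) \<in> B \<Longrightarrow>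
          (Comp C m k, n) \<in> B"
    and pullback_bicovering: "(m, n) \<in> B \<Longrightarrow> is_pullback C f m m' r \<Longrightarrow>
          is_pullback C f n n' s \<Longrightarrow> (m', n') \<in> B"

text \<open>
  \<open>u\<close> is the map induced on pullbacks; whether it has a right inverse does not depend on which
  pullbacks are taken.
\<close>

definition bicovering_morphism ::
  "('o, 'a, 'z) cat_scheme \<Rightarrow> 'a \<times> 'a \<Rightarrow> 'a \<times> 'a \<Rightarrow> 'a \<Rightarrow> 'a \<Rightarrow> 'a \<Rightarrow> bool" where
  "bicovering_morphism C = (\<lambda>(m', n') (m, n) qa qb qc.
     qa \<in> hom C (Dom C m') (Dom C m) \<and>
     qb \<in> hom C (Dom C n') (Dom C n) \<and>
     qc \<in> hom C (Cod C m') (Cod C m) \<and>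
     Comp C qc m' = Comp C m qa \<and> Comp C qc n' = Comp C n qb \<and>
     (\<exists>p' q' p q u. is_pullback C m' n' p' q' \<and> is_pullback C m n p q \<and>
        u \<in> hom C (Dom C p') (Dom C p) \<and>
        Comp C p u = Comp C qa p' \<and> Comp C q u = Comp C qb q' \<and>
        has_right_inverse C u))"

section \<open>The category of sets\<close>

text \<open>
  Sets are the subsets of the type \<open>'u\<close> of cardinality smaller than \<open>'u\<close>. If the cardinality of
  \<open>'u\<close> is a regular strong limit, this is, up to equivalence, the category of sets of a
  Grothendieck universe. No uncountability is imposed: for \<open>'u = nat\<close> the small sets are the
  finite ones, and the predicate below is therefore satisfiable.
\<close>

definition small :: "'u set \<Rightarrow> bool" where
  "small A \<longleftrightarrow> A \<prec> (UNIV :: 'u set)"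

definition universe :: "'u itself \<Rightarrow> bool" where
  "universe TYPE('u) \<longleftrightarrow>
     infinite (UNIV :: 'u set) \<and>
     (\<forall>A :: 'u set. small A \<longrightarrow> Pow A \<prec> (UNIV :: 'u set)) \<and>
     (\<forall>(I :: 'u set) (A :: 'u \<Rightarrow> 'u set).
        small I \<and> (\<forall>i\<in>I. small (A i)) \<longrightarrow> small (\<Union>i\<in>I. A i))"

lemma small_nat_iff: "small (A :: nat set) \<longleftrightarrow> finite A"
  unfolding small_def
  by (metis (full_types) countable_lesspoll countable_infiniteE' countableI_type eqpoll_def
      finite_lesspoll_infinite infinite_UNIV_nat lesspoll_def bij_betw_inv)

lemma universe_nat: "universe TYPE(nat)"
  by (auto simp: universe_def small_nat_iff finite_lesspoll_infinite)

section \<open>Gleaves\<close>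

record ('o, 'a, 'u) gleaf =
  FOb :: "'o \<Rightarrow> 'u set"
  FMap :: "'a \<Rightarrow> 'u \<Rightarrow> 'u"
  Glue :: "'a \<times> 'a \<Rightarrow> 'u \<times> 'u \<Rightarrow> 'u"

text \<open>\<open>matching C F (m, n)\<close> is the fibre product \<open>F a \<times>\<^bsub>F (a \<times>\<^sub>c b)\<^esub> F b\<close> for \<open>m : a \<rightarrow> c\<close>, \<open>n : b \<rightarrow> c\<close>.\<close>

definition matching ::
  "('o, 'a, 'z) cat_scheme \<Rightarrow> ('o, 'a, 'u) gleaf \<Rightarrow> 'a \<times> 'a \<Rightarrow> ('u \<times> 'u) set" where
  "matching C F = (\<lambda>(m, n). {(x, y). x \<in> FOb F (Dom C m) \<and> y \<in> FOb F (Dom C n) \<and>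
     (\<exists>p q. is_pullback C m n p q \<and> FMap F p x = FMap F q y)})"

text \<open>
  All functions are extensional (\<open>undefined\<close> outside their domain), so that equality of gleaves
  and of their morphisms is the mathematical one.
\<close>

locale presheaf = category C
  for C :: "('o, 'a, 'z) cat_scheme" +
  fixes F :: "('o, 'a, 'u) gleaf"
  assumes FOb_extensional: "FOb F \<in> extensional (Ob C)"
    and FOb_small: "c \<in> Ob C \<Longrightarrow> small (FOb F c)"
    and FMap_PiE: "FMap F \<in> (\<Pi>\<^sub>E f\<in>Arr C. FOb F (Cod C f) \<rightarrow>\<^sub>E FOb F (Dom C f))"
    and FMap_Idt: "c \<in> Ob C \<Longrightarrow> x \<in> FOb F c \<Longrightarrow> FMap F (Idt C c) x = x"
    and FMap_Comp: "f \<in> hom C a b \<Longrightarrow> g \<in> hom C b c \<Longrightarrow> x \<in> FOb F c \<Longrightarrow>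
          FMap F (Comp C g f) x = FMap F f (FMap F g x)"

locale gleaf = bicovering_system C B + presheaf C F
  for C :: "('o, 'a, 'z) cat_scheme" and B :: "('a \<times> 'a) set" and F :: "('o, 'a, 'u) gleaf" +
  assumes Glue_PiE: "Glue F \<in> (\<Pi>\<^sub>E mn\<in>B. matching C F mn \<rightarrow>\<^sub>E FOb F (Cod C (fst mn)))"
    and Glue_swap: "(m, n) \<in> B \<Longrightarrow> (x, y) \<in> matching C F (m, n) \<Longrightarrow>
          Glue F (n, m) (y, x) = Glue F (m, n) (x, y)"
    and Glue_Idt_left: "(Idt C a, n) \<in> B \<Longrightarrow> a \<in> Ob C \<Longrightarrow>
          (x, y) \<in> matching C F (Idt C a, n) \<Longrightarrow> Glue F (Idt C a, n) (x, y) = x"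
    and Glue_Idt_right: "(m, Idt C b) \<in> B \<Longrightarrow> b \<in> Ob C \<Longrightarrow>
          (x, y) \<in> matching C F (m, Idt C b) \<Longrightarrow> Glue F (m, Idt C b) (x, y) = y"
    and back_and_forth: "(m, n) \<in> B \<Longrightarrow> is_pullback C m n p q \<Longrightarrow> (k, p) \<in> B \<Longrightarrow>
          (x, y) \<in> matching C F (Comp C m k, n) \<Longrightarrow>
          s = Glue F (Comp C m k, n) (x, y) \<Longrightarrow>
          Glue F (m, n) (FMap F m s, FMap F n s) = s"
    and partial_naturality: "(m', n') \<in> B \<Longrightarrow> (m, n) \<in> B \<Longrightarrow>
          bicovering_morphism C (m', n') (m, n) qa qb qc \<Longrightarrow>
          (x, y) \<in> matching C F (m, n) \<Longrightarrow>
          FMap F qc (Glue F (m, n) (x, y)) = Glue F (m', n') (FMap F qa x, FMap F qb y)"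

definition gleaf_hom ::
  "('o, 'a, 'z) cat_scheme \<Rightarrow> ('a \<times> 'a) set \<Rightarrow> ('o, 'a, 'u) gleaf \<Rightarrow> ('o, 'a, 'u) gleaf \<Rightarrow>
    ('o \<Rightarrow> 'u \<Rightarrow> 'u) set" where
  "gleaf_hom C B F G = {\<eta> \<in> (\<Pi>\<^sub>E c\<in>Ob C. FOb F c \<rightarrow>\<^sub>E FOb G c).
     (\<forall>f\<in>Arr C. \<forall>x\<in>FOb F (Cod C f).
        \<eta> (Dom C f) (FMap F f x) = FMap G f (\<eta> (Cod C f) x)) \<and>
     (\<forall>(m, n)\<in>B. \<forall>(x, y)\<in>matching C F (m, n).
        \<eta> (Cod C m) (Glue F (m, n) (x, y)) = Glue G (m, n) (\<eta> (Dom C m) x, \<eta> (Dom C n) y))}"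

definition Gl ::
  "('o, 'a, 'z) cat_scheme \<Rightarrow> ('a \<times> 'a) set \<Rightarrow> 'u itself \<Rightarrow>
    (('o, 'a, 'u) gleaf,
     ('o, 'a, 'u) gleaf \<times> ('o \<Rightarrow> 'u \<Rightarrow> 'u) \<times> ('o, 'a, 'u) gleaf) cat" where
  "Gl C B (U :: 'u itself) =
     \<lparr> Ob = {F. gleaf C B F},
       Arr = {(F, \<eta>, G). gleaf C B F \<and> gleaf C B G \<and> \<eta> \<in> gleaf_hom C B F G},
       Dom = (\<lambda>(F, \<eta>, G). F),
       Cod = (\<lambda>(F, \<eta>, G). G),
       Idt = (\<lambda>F. (F, \<lambda>c\<in>Ob C. \<lambda>x\<in>FOb F c. x, F)),
       Comp = (\<lambda>(G', \<theta>, H) (F, \<eta>, G). (F, \<lambda>c\<in>Ob C. \<lambda>x\<in>FOb F c. \<theta> c (\<eta> c x), H)) \<rparr>"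

lemma gleaf_hom_matching:
  assumes "bicovering_system C B" "\<eta> \<in> gleaf_hom C B F G" "mn \<in> B" "(x, y) \<in> matching C F mn"
  shows "(\<eta> (Dom C (fst mn)) x, \<eta> (Dom C (snd mn)) y) \<in> matching C G mn"
proof -
  interpret bicovering_system C B by fact
  obtain m n where mn: "mn = (m, n)" by (cases mn)
  obtain p q where pq: "is_pullback C m n p q" "FMap F p x = FMap F q y"
    and x: "x \<in> FOb F (Dom C m)" and y: "y \<in> FOb F (Dom C n)"
    using assms(4) by (auto simp: matching_def mn)
  have p: "p \<in> Arr C" "Cod C p = Dom C m" and q: "q \<in> Arr C" "Cod C q = Dom C n" "Dom C q = Dom C p"
    using pq(1) by (auto simp: is_pullback_def hom_def)
  have m: "Dom C m \<in> Ob C" "Dom C n \<in> Ob C"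
    using assms(3) cospan Dom_Ob by (auto simp: mn)
  have nat: "\<And>f x. f \<in> Arr C \<Longrightarrow> x \<in> FOb F (Cod C f) \<Longrightarrow>
      \<eta> (Dom C f) (FMap F f x) = FMap G f (\<eta> (Cod C f) x)"
    and fn: "\<And>c x. c \<in> Ob C \<Longrightarrow> x \<in> FOb F c \<Longrightarrow> \<eta> c x \<in> FOb G c"
    using assms(2) by (auto simp: gleaf_hom_def PiE_def Pi_def)
  have "FMap G p (\<eta> (Dom C m) x) = FMap G q (\<eta> (Dom C n) y)"
    using nat[of p x] nat[of q y] p q x y pq(2) by simp
  then show ?thesis
    using pq(1) x y m fn by (auto simp: matching_def mn)
qed

lemma gleaf_hom_Idt:
  assumes "gleaf C B F"
  shows "(\<lambda>c\<in>Ob C. \<lambda>x\<in>FOb F c. x) \<in> gleaf_hom C B F F"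
proof -
  interpret gleaf C B F by fact
  have mem: "FMap F f x \<in> FOb F (Dom C f)" if "f \<in> Arr C" "x \<in> FOb F (Cod C f)" for f x
    using FMap_PiE that by (auto simp: PiE_def Pi_def)
  have glue: "Glue F (m, n) (x, y) \<in> FOb F (Cod C m)"
    if "(m, n) \<in> B" "(x, y) \<in> matching C F (m, n)" for m n x y
    using PiE_mem[OF PiE_mem[OF Glue_PiE that(1)] that(2)] by simp
  show ?thesis
    using mem glue cospan Dom_Ob Cod_Ob by (fastforce simp: gleaf_hom_def matching_def)
qed

lemma gleaf_hom_Comp:
  assumes "gleaf C B F" "\<eta> \<in> gleaf_hom C B F G" "\<theta> \<in> gleaf_hom C B G H"
  shows "(\<lambda>c\<in>Ob C. \<lambda>x\<in>FOb F c. \<theta> c (\<eta> c x)) \<in> gleaf_hom C B F H"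
proof -
  interpret gleaf C B F by fact
  have mem: "FMap F f x \<in> FOb F (Dom C f)" if "f \<in> Arr C" "x \<in> FOb F (Cod C f)" for f x
    using FMap_PiE that by (auto simp: PiE_def Pi_def)
  have glue: "Glue F (m, n) (x, y) \<in> FOb F (Cod C m)"
    if "(m, n) \<in> B" "(x, y) \<in> matching C F (m, n)" for m n x y
    using PiE_mem[OF PiE_mem[OF Glue_PiE that(1)] that(2)] by simp
  have fn: "\<And>c x. c \<in> Ob C \<Longrightarrow> x \<in> FOb F c \<Longrightarrow> \<eta> c x \<in> FOb G c"
    "\<And>c x. c \<in> Ob C \<Longrightarrow> x \<in> FOb G c \<Longrightarrow> \<theta> c x \<in> FOb H c"
    using assms(2,3) by (auto simp: gleaf_hom_def PiE_def Pi_def)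
  have nat: "\<And>f x. f \<in> Arr C \<Longrightarrow> x \<in> FOb F (Cod C f) \<Longrightarrow>
      \<eta> (Dom C f) (FMap F f x) = FMap G f (\<eta> (Cod C f) x)"
    "\<And>f x. f \<in> Arr C \<Longrightarrow> x \<in> FOb G (Cod C f) \<Longrightarrow>
      \<theta> (Dom C f) (FMap G f x) = FMap H f (\<theta> (Cod C f) x)"
    using assms(2,3) by (auto simp: gleaf_hom_def)
  have gl: "\<And>m n x y. (m, n) \<in> B \<Longrightarrow> (x, y) \<in> matching C F (m, n) \<Longrightarrow>
      \<eta> (Cod C m) (Glue F (m, n) (x, y)) = Glue G (m, n) (\<eta> (Dom C m) x, \<eta> (Dom C n) y)"
    "\<And>m n x y. (m, n) \<in> B \<Longrightarrow> (x, y) \<in> matching C G (m, n) \<Longrightarrow>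
      \<theta> (Cod C m) (Glue G (m, n) (x, y)) = Glue H (m, n) (\<theta> (Dom C m) x, \<theta> (Dom C n) y)"
    using assms(2,3) by (auto simp: gleaf_hom_def)
  have match: "(\<eta> (Dom C m) x, \<eta> (Dom C n) y) \<in> matching C G (m, n)"
    if "(m, n) \<in> B" "(x, y) \<in> matching C F (m, n)" for m n x y
    using gleaf_hom_matching[OF bicovering_system_axioms assms(2) that] by simp
  let ?k = "\<lambda>c\<in>Ob C. \<lambda>x\<in>FOb F c. \<theta> c (\<eta> c x)"
  have "?k \<in> (\<Pi>\<^sub>E c\<in>Ob C. FOb F c \<rightarrow>\<^sub>E FOb H c)"
    using fn by auto
  moreover have "?k (Dom C f) (FMap F f x) = FMap H f (?k (Cod C f) x)"
    if "f \<in> Arr C" "x \<in> FOb F (Cod C f)" for f x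
    using that mem nat fn Dom_Ob Cod_Ob by simp
  moreover have "?k (Cod C m) (Glue F (m, n) (x, y)) = Glue H (m, n) (?k (Dom C m) x, ?k (Dom C n) y)"
    if "(m, n) \<in> B" "(x, y) \<in> matching C F (m, n)" for m n x y
  proof -
    have "x \<in> FOb F (Dom C m)" "y \<in> FOb F (Dom C n)"
      using that(2) by (auto simp: matching_def)
    moreover have "Dom C m \<in> Ob C" "Dom C n \<in> Ob C" "Cod C m \<in> Ob C"
      using cospan[OF that(1)] Dom_Ob Cod_Ob by auto
    ultimately show ?thesis
      using glue[OF that] gl(1)[OF that] gl(2)[OF that(1) match[OF that]] by simp
  qed
  ultimately show ?thesis
    unfolding gleaf_hom_def by blast
qed

lemma hom_Gl:
  "hom (Gl C B TYPE('u)) F G =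
     {(F, \<eta>, G) |\<eta>. gleaf C B F \<and> gleaf C B G \<and> \<eta> \<in> gleaf_hom C B F G}"
  by (auto simp: hom_def Gl_def)

lemma category_Gl:
  "category (Gl C B TYPE('u))"
proof
  have ext: "(\<lambda>c\<in>Ob C. \<lambda>x\<in>FOb F c. \<eta> c x) = \<eta>" if "\<eta> \<in> gleaf_hom C B F G"
    for F G :: "('a, 'b, 'u) gleaf" and \<eta>
  proof -
    have "\<eta> \<in> (\<Pi>\<^sub>E c\<in>Ob C. FOb F c \<rightarrow>\<^sub>E FOb G c)"
      using that by (simp add: gleaf_hom_def)
    then have "\<eta> \<in> extensional (Ob C)" "\<And>c. c \<in> Ob C \<Longrightarrow> \<eta> c \<in> extensional (FOb F c)"
      by (auto simp: PiE_def Pi_def)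
    then show ?thesis
      by (auto simp: fun_eq_iff restrict_def extensional_def)
  qed
  have fn: "\<eta> c x \<in> FOb G c" if "\<eta> \<in> gleaf_hom C B F G" "c \<in> Ob C" "x \<in> FOb F c"
    for F G :: "('a, 'b, 'u) gleaf" and \<eta> c x
    using that by (auto simp: gleaf_hom_def PiE_def Pi_def)
  let ?G = "Gl C B TYPE('u)"
  show "Dom ?G f \<in> Ob ?G" "Cod ?G f \<in> Ob ?G" if "f \<in> Arr ?G" for f
    using that by (auto simp: Gl_def)
  show "Idt ?G F \<in> hom ?G F F" if "F \<in> Ob ?G" for F
    using that gleaf_hom_Idt by (auto simp: hom_Gl) (auto simp: Gl_def)
  show "Comp ?G g f \<in> hom ?G F H" if "f \<in> hom ?G F G" "g \<in> hom ?G G H" for f g F G H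
    using that gleaf_hom_Comp by (auto simp: hom_Gl) (auto simp: Gl_def)
  show "Comp ?G (Idt ?G G) f = f" if "f \<in> hom ?G F G" for f F G
  proof -
    obtain \<eta> where f: "f = (F, \<eta>, G)" and \<eta>: "\<eta> \<in> gleaf_hom C B F G"
      using \<open>f \<in> hom ?G F G\<close> by (auto simp: hom_Gl)
    have "(\<lambda>c\<in>Ob C. \<lambda>x\<in>FOb F c. (\<lambda>c\<in>Ob C. \<lambda>x\<in>FOb G c. x) c (\<eta> c x)) =
        (\<lambda>c\<in>Ob C. \<lambda>x\<in>FOb F c. \<eta> c x)"
      by (auto intro!: restrict_ext simp: fn[OF \<eta>])
    then show ?thesis by (simp add: f Gl_def ext[OF \<eta>])
  qed
  show "Comp ?G f (Idt ?G F) = f" if "f \<in> hom ?G F G" for f F G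
  proof -
    obtain \<eta> where f: "f = (F, \<eta>, G)" and \<eta>: "\<eta> \<in> gleaf_hom C B F G"
      using \<open>f \<in> hom ?G F G\<close> by (auto simp: hom_Gl)
    have "(\<lambda>c\<in>Ob C. \<lambda>x\<in>FOb F c. \<eta> c ((\<lambda>c\<in>Ob C. \<lambda>x\<in>FOb F c. x) c x)) =
        (\<lambda>c\<in>Ob C. \<lambda>x\<in>FOb F c. \<eta> c x)"
      by (auto intro!: restrict_ext)
    then show ?thesis by (simp add: f Gl_def ext[OF \<eta>])
  qed
  show "Comp ?G h (Comp ?G g f) = Comp ?G (Comp ?G h g) f"
    if "f \<in> hom ?G F G" "g \<in> hom ?G G H" "h \<in> hom ?G H K" for f g h F G H K
    using that by (auto simp: hom_Gl) (auto simp: Gl_def fn intro!: restrict_ext)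
qed

end

theory Submission
  imports Defs "HOL-Library.Nat_Bijection"
begin

text \<open>
  The base category is the poset of divisors of six, ordered by divisibility: a square with bottom
  \<open>1\<close>, incomparable middle elements \<open>2\<close> and \<open>3\<close>, and top \<open>6\<close>. The bicoverings are all cospans
  \<open>a \<rightarrow> lcm a b \<leftarrow> b\<close>; the axioms hold because the lattice is distributive. Only the cospan
  \<open>2 \<rightarrow> 6 \<leftarrow> 3\<close> carries information, since the glueing along a cospan with an identity leg is
  prescribed. So a gleaf is a presheaf \<open>F\<close> together with a section \<open>join\<close> of the restriction
  \<open>F 6 \<rightarrow> F 2 \<times>\<^bsub>F 1\<^esub> F 3\<close>: matching elements can be glued, but an element of \<open>F 6\<close> need not be the
  glueing of its restrictions.

  \<^emph>\<open>Not cartesian closed.\<close> If the exponential \<open>Y\<^sup>X\<close> exists, then multiplying an epimorphism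
  with \<open>X\<close> yields an arrow that is still cancellable for arrows into \<open>Y\<close>
  (\<open>exponential_product_epi\<close>). Glueing breaks this. Let the gleaf \<open>pieces\<close> have one element over
  \<open>2\<close> and one over \<open>3\<close>, lying over two different elements over \<open>1\<close>, and no element over \<open>6\<close>. Its map
  to the terminal gleaf is an epimorphism, as the element over \<open>6\<close> of the terminal gleaf is glued
  from elements that are hit. Let \<open>X\<close> be the free gleaf on an element over \<open>6\<close>; besides this generator
  it has over \<open>6\<close> the glueing of the restrictions of the generator. The product of \<open>pieces\<close> with \<open>X\<close> is
  again empty over \<open>6\<close>, so it detects neither of these two elements, and the identity of \<open>X\<close> agrees
  on it with the endomorphism that sends the generator to the glueing.

  \<^emph>\<open>Subobject classifier.\<close> As for presheaves, \<open>\<Omega>\<close> consists of sieves, and the characteristic map of a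
  subobject sends \<open>y\<close> to the sieve of those \<open>e\<close> for which \<open>y\<close> restricted to \<open>e\<close> lies in the subobject.
  A glueing of \<open>y\<close> and \<open>z\<close> lies in a subgleaf iff \<open>y\<close> and \<open>z\<close> do, because subgleaves are closed
  under restriction and glueing. Hence the sieve of a glueing is determined by the sieves of \<open>y\<close> and
  \<open>z\<close>. This defines the glueing on \<open>\<Omega>\<close> and makes characteristic maps gleaf morphisms. Monomorphisms
  are pointwise injective, and a characteristic map is unique, because every element of a gleaf is the
  image of the generator of a free gleaf (\<open>yoneda_hom\<close>, \<open>yoneda_unique\<close>).
\<close>

section \<open>The divisors of six and their bicoverings\<close>

definition arr :: "nat \<Rightarrow> nat \<Rightarrow> nat" where
  "arr a b = prod_encode (a, b)"

definition Div :: "(nat, nat) cat" where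
  "Div = \<lparr> Ob = {d. d dvd 6}, Arr = {arr a b |a b. a dvd b \<and> b dvd 6},
     Dom = (\<lambda>f. fst (prod_decode f)), Cod = (\<lambda>f. snd (prod_decode f)),
     Idt = (\<lambda>a. arr a a),
     Comp = (\<lambda>g f. arr (fst (prod_decode f)) (snd (prod_decode g))) \<rparr>"

definition Cov :: "(nat \<times> nat) set" where
  "Cov = {(arr a c, arr b c) |a b c. c = lcm a b \<and> c dvd 6}"

lemma Div_simps [simp]:
  "arr a b = arr a' b' \<longleftrightarrow> a = a' \<and> b = b'"
  "Ob Div = {d. d dvd 6}"
  "arr a b \<in> Arr Div \<longleftrightarrow> a dvd b \<and> b dvd 6"
  "Dom Div (arr a b) = a" "Cod Div (arr a b) = b"
  "Idt Div a = arr a a"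
  "Comp Div (arr b' c) (arr a b) = arr a c"
  by (auto simp: Div_def arr_def)

lemma Arr_Div: "f \<in> Arr Div \<longleftrightarrow> (\<exists>a b. f = arr a b \<and> a dvd b \<and> b dvd 6)"
  by (auto simp: Div_def)

lemma hom_Div: "hom Div a b = (if a dvd b \<and> b dvd 6 then {arr a b} else {})"
  by (auto simp: hom_def Arr_Div)

lemma category_Div: "category Div"
  by unfold_locales (auto simp: Arr_Div hom_Div split: if_splits intro: dvd_trans)

lemma monic_Div: "monic Div f \<longleftrightarrow> f \<in> Arr Div"
  by (auto simp: monic_def hom_Div split: if_splits)

text \<open>
  In a poset, the pullback of two elements below a common bound is their meet, which is the greatest
  common divisor here.
\<close>

lemma is_pullback_Div:
  "is_pullback Div f g p q \<longleftrightarrow>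
     (\<exists>a b c. a dvd c \<and> b dvd c \<and> c dvd 6 \<and> f = arr a c \<and> g = arr b c \<and>
        p = arr (gcd a b) a \<and> q = arr (gcd a b) b)" (is "?L \<longleftrightarrow> ?R")
proof
  assume L: ?L
  then obtain a b c where f: "f = arr a c" "a dvd c" "c dvd 6" and g: "g = arr b c" "b dvd c"
    unfolding is_pullback_def by (auto simp: Arr_Div)
  from L obtain d where pq: "p = arr d a" "q = arr d b" "d dvd a" "d dvd b"
    unfolding is_pullback_def by (auto simp: f g hom_Div split: if_splits)
  have gc: "gcd a b dvd 6" "a dvd 6" "b dvd 6"
    using f g by (auto intro: dvd_trans)
  have "\<exists>!u. u \<in> hom Div (gcd a b) (Dom Div p) \<and> Comp Div p u = arr (gcd a b) a \<and>
      Comp Div q u = arr (gcd a b) b"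
    using L gc unfolding is_pullback_def by (auto simp: f g hom_Div)
  then have "gcd a b dvd d"
    by (auto simp: pq hom_Div split: if_splits)
  then have "d = gcd a b" using pq by (simp add: dvd_antisym)
  then show ?R using f g pq by blast
next
  assume ?R
  then obtain a b c where abc: "a dvd c" "b dvd c" "c dvd 6"
    and eqs: "f = arr a c" "g = arr b c" "p = arr (gcd a b) a" "q = arr (gcd a b) b" by blast
  have "a dvd 6" "b dvd 6" "gcd a b dvd 6"
    using abc by (auto intro: dvd_trans)
  then show ?L
    using abc unfolding is_pullback_def eqs by (auto simp: hom_Div split: if_splits)
qed

lemma dvd_6_iff: "d dvd 6 \<longleftrightarrow> d \<in> {1, 2, 3, 6::nat}"
proof
  assume d: "d dvd 6"
  then have "d \<le> 6" by (simp add: dvd_imp_le)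
  then consider "d = 0" | "d = 1" | "d = 2" | "d = 3" | "d = 4" | "d = 5" | "d = 6" by linarith
  then show "d \<in> {1, 2, 3, 6}" using d by cases auto
qed auto

lemma CovE:
  assumes "(m, n) \<in> Cov"
  obtains a b c where "m = arr a c" "n = arr b c" "a dvd c" "b dvd c" "c dvd 6" "c = lcm a b"
    "a dvd 6" "b dvd 6"
  using assms by (auto simp: Cov_def intro: dvd_trans)

lemma Cov_arr: "(arr a c, arr b c') \<in> Cov \<longleftrightarrow> c' = c \<and> c = lcm a b \<and> c dvd 6"
  by (auto simp: Cov_def)

text \<open>
  Distributivity of the lattice of divisors; it is what makes bicoverings stable under pullback.
\<close>

lemma gcd_lcm_distrib_6:
  assumes "a dvd 6" "b dvd 6" "d dvd lcm a b"
  shows "lcm (gcd d a) (gcd d b) = (d::nat)"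
proof -
  have "lcm a b dvd 6" using assms by simp
  then have "d dvd 6" using assms(3) dvd_trans by blast
  show ?thesis
    using assms \<open>d dvd 6\<close> unfolding dvd_6_iff by (auto simp: lcm_nat_def)
qed

lemma bicovering_system_Div: "bicovering_system Div Cov"
proof -
  interpret category Div by (rule category_Div)
  show ?thesis
  proof
    fix m n assume mn: "(m, n) \<in> Cov"
    show "m \<in> Arr Div \<and> n \<in> Arr Div \<and> Cod Div m = Cod Div n" "monic Div m \<and> monic Div n"
      using mn by (auto simp: Cov_def monic_Div)
    show "(n, m) \<in> Cov" using mn by (auto simp: Cov_def lcm.commute)
    show "\<exists>p q. is_pullback Div m n p q" using mn by (auto elim!: CovE simp: is_pullback_Div)
  next
    fix a assume "a \<in> Ob Div"
    then show "(Idt Div a, Idt Div a) \<in> Cov" by (auto simp: Cov_def)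
  next
    fix m n p q k assume "(m, n) \<in> Cov" "is_pullback Div m n p q" "(k, p) \<in> Cov"
    then obtain a b a' where "m = arr a (lcm a b)" "n = arr b (lcm a b)" "k = arr a' a"
      "lcm a' (gcd a b) = a" "lcm a b dvd 6"
      by (fastforce simp: Cov_def is_pullback_Div)
    moreover have "lcm a' b = lcm (lcm a' (gcd a b)) b"
      by (simp add: lcm.assoc)
    ultimately show "(Comp Div m k, n) \<in> Cov"
      by (simp add: Cov_arr)
  next
    fix m n f m' n' r s
    assume A: "(m, n) \<in> Cov" and p: "is_pullback Div f m m' r" "is_pullback Div f n n' s"
    from A obtain a b where mn: "m = arr a (lcm a b)" "n = arr b (lcm a b)" "a dvd 6" "b dvd 6"
      by (auto elim!: CovE)
    from p(1) obtain d where d: "f = arr d (lcm a b)" "d dvd lcm a b" "m' = arr (gcd d a) d"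
      by (auto simp: is_pullback_Div mn)
    from p(2) have "n' = arr (gcd d b) d"
      by (auto simp: is_pullback_Div mn d)
    moreover have "d dvd 6" using d(2) mn by (meson dvd_trans lcm_least)
    ultimately show "(m', n') \<in> Cov"
      using gcd_lcm_distrib_6[OF mn(3,4) d(2)] by (simp add: Cov_arr d)
  qed
qed

section \<open>Gleaves on the divisors of six\<close>

text \<open>
  All bicoverings other than \<open>2 \<rightarrow> 6 \<leftarrow> 3\<close> have an identity leg.
\<close>

lemma incomparable_divisors_6:
  assumes "a dvd 6" "b dvd 6" "\<not> a dvd b" "\<not> b dvd (a::nat)"
  shows "a = 2 \<and> b = 3 \<or> a = 3 \<and> b = 2"
  using assms unfolding dvd_6_iff by auto

lemma matching_Div:
  assumes "a dvd c" "b dvd c" "c dvd 6"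
  shows "matching Div F (arr a c, arr b c) =
    {(x, y). x \<in> FOb F a \<and> y \<in> FOb F b \<and>
       FMap F (arr (gcd a b) a) x = FMap F (arr (gcd a b) b) y}"
  using assms by (auto simp: matching_def is_pullback_Div)

text \<open>
  An arrow of a poset with a right inverse is an identity. So a morphism of bicoverings preserves the
  intersection of the legs on the nose.
\<close>

lemma bicovering_morphism_Div:
  assumes "bicovering_morphism Div (arr a' c', arr b' c') (arr a c, arr b c) qa qb qc"
  shows "qa = arr a' a" "qb = arr b' b" "qc = arr c' c" "a' dvd a" "b' dvd b" "c' dvd c"
    "gcd a' b' = gcd a b"
proof -
  from assms obtain u where q: "qa \<in> hom Div a' a" "qb \<in> hom Div b' b" "qc \<in> hom Div c' c"
    and u: "u \<in> hom Div (gcd a' b') (gcd a b)" "has_right_inverse Div u"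
    by (auto simp: bicovering_morphism_def is_pullback_Div)
  then show "qa = arr a' a" "qb = arr b' b" "qc = arr c' c" "a' dvd a" "b' dvd b" "c' dvd c"
    by (auto simp: hom_Div split: if_splits)
  from u have "gcd a' b' dvd gcd a b" "gcd a b dvd gcd a' b'"
    by (auto simp only: hom_Div has_right_inverse_def Div_simps split: if_splits)
  then show "gcd a' b' = gcd a b" by (rule dvd_antisym)
qed

lemma bicovering_morphism_DivI:
  assumes "a' dvd a" "b' dvd b" "c' dvd c" "gcd a' b' = gcd a b"
    "a' dvd c'" "b' dvd c'" "a dvd c" "b dvd c" "c dvd 6"
  shows "bicovering_morphism Div (arr a' c', arr b' c') (arr a c, arr b c)
           (arr a' a) (arr b' b) (arr c' c)"
proof -
  have "c' dvd 6" "a dvd 6" "b dvd 6" "gcd a b dvd 6"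
    using assms by (auto intro: dvd_trans)
  with assms have 1: "is_pullback Div (arr a' c') (arr b' c') (arr (gcd a b) a') (arr (gcd a b) b')"
    "is_pullback Div (arr a c) (arr b c) (arr (gcd a b) a) (arr (gcd a b) b)"
    by (auto simp: is_pullback_Div)
  have 2: "has_right_inverse Div (arr (gcd a b) (gcd a b))"
    using \<open>gcd a b dvd 6\<close> by (auto simp: has_right_inverse_def hom_Div)
  have "\<exists>p' q' p q u. is_pullback Div (arr a' c') (arr b' c') p' q' \<and>
      is_pullback Div (arr a c) (arr b c) p q \<and> u \<in> hom Div (Dom Div p') (Dom Div p) \<and>
      Comp Div p u = Comp Div (arr a' a) p' \<and> Comp Div q u = Comp Div (arr b' b) q' \<and>
      has_right_inverse Div u"
    by (rule exI[of _ "arr (gcd a b) a'"], rule exI[of _ "arr (gcd a b) b'"],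
        rule exI[of _ "arr (gcd a b) a"], rule exI[of _ "arr (gcd a b) b"],
        rule exI[of _ "arr (gcd a b) (gcd a b)"])
      (use 1 2 \<open>gcd a b dvd 6\<close> in \<open>simp add: hom_Div\<close>)
  then show ?thesis
    unfolding bicovering_morphism_def prod.case
    using assms \<open>c' dvd 6\<close> \<open>a dvd 6\<close> \<open>b dvd 6\<close> by (simp add: hom_Div)
qed

text \<open>
  If one leg is an identity, the identity axioms prescribe its argument; otherwise the legs come from
  \<open>2\<close> and \<open>3\<close>, in one of the two orders.
\<close>

definition glue_by :: "('u \<Rightarrow> 'u \<Rightarrow> 'u) \<Rightarrow> nat \<Rightarrow> nat \<Rightarrow> 'u \<Rightarrow> 'u \<Rightarrow> 'u" where
  "glue_by \<gamma> a b x y =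
     (if b dvd a then x else if a dvd b then y else if a = 2 then \<gamma> x y else \<gamma> y x)"

text \<open>
  All gleaves needed below have restrictions that depend on the target only: \<open>r d\<close> restricts to \<open>d\<close>
  from any larger divisor. They are determined by \<open>r\<close> and the glueing \<open>\<gamma>\<close> along \<open>2 \<rightarrow> 6 \<leftarrow> 3\<close>, in this
  order of the legs.
\<close>

definition mk_gleaf ::
  "(nat \<Rightarrow> 'u set) \<Rightarrow> (nat \<Rightarrow> 'u \<Rightarrow> 'u) \<Rightarrow> ('u \<Rightarrow> 'u \<Rightarrow> 'u) \<Rightarrow> (nat, nat, 'u) gleaf" where
  "mk_gleaf S r \<gamma> =
     \<lparr> FOb = (\<lambda>d\<in>Ob Div. S d),
       FMap = (\<lambda>f\<in>Arr Div. \<lambda>x\<in>S (Cod Div f). r (Dom Div f) x),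
       Glue = (\<lambda>(m, n)\<in>Cov.
         \<lambda>(x, y)\<in>{(x, y). x \<in> S (Dom Div m) \<and> y \<in> S (Dom Div n) \<and>
             r (gcd (Dom Div m) (Dom Div n)) x = r (gcd (Dom Div m) (Dom Div n)) y}.
           glue_by \<gamma> (Dom Div m) (Dom Div n) x y) \<rparr>"

lemma mk_gleaf_FOb [simp]: "d dvd 6 \<Longrightarrow> FOb (mk_gleaf S r \<gamma>) d = S d"
  by (simp add: mk_gleaf_def)

lemma mk_gleaf_FMap [simp]:
  "d dvd c \<Longrightarrow> c dvd 6 \<Longrightarrow> x \<in> S c \<Longrightarrow> FMap (mk_gleaf S r \<gamma>) (arr d c) x = r d x"
  by (simp add: mk_gleaf_def)

lemma matching_mk_gleaf:
  assumes "a dvd c" "b dvd c" "c dvd 6"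
  shows "matching Div (mk_gleaf S r \<gamma>) (arr a c, arr b c) =
    {(x, y). x \<in> S a \<and> y \<in> S b \<and> r (gcd a b) x = r (gcd a b) y}"
proof -
  have "a dvd 6" "b dvd 6" using assms by (auto intro: dvd_trans)
  then show ?thesis using assms by (auto simp: matching_Div)
qed

lemma mk_gleaf_Glue:
  assumes "(arr a c, arr b c) \<in> Cov" "x \<in> S a" "y \<in> S b" "r (gcd a b) x = r (gcd a b) y"
  shows "Glue (mk_gleaf S r \<gamma>) (arr a c, arr b c) (x, y) = glue_by \<gamma> a b x y"
  using assms by (simp add: mk_gleaf_def)

text \<open>
  A presheaf and a section of its restriction to matching pairs give a gleaf. All glueings are then
  sections of restriction, and the remaining axioms follow: back-and-forth from the fact that
  \<open>2 \<rightarrow> 6 \<leftarrow> 3\<close> cannot be obtained by a proper composition, partial naturality from the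
  fact that a morphism out of it, preserving the intersection, is an identity.
\<close>

lemma gleaf_mk_gleaf:
  assumes small: "\<And>d. d dvd 6 \<Longrightarrow> small (S d)"
    and mem: "\<And>d c x. d dvd c \<Longrightarrow> c dvd 6 \<Longrightarrow> x \<in> S c \<Longrightarrow> r d x \<in> S d"
    and idt: "\<And>c x. c dvd 6 \<Longrightarrow> x \<in> S c \<Longrightarrow> r c x = x"
    and comp: "\<And>b d c x. b dvd d \<Longrightarrow> d dvd c \<Longrightarrow> c dvd 6 \<Longrightarrow> x \<in> S c \<Longrightarrow> r b (r d x) = r b x"
    and glue: "\<And>x y. x \<in> S 2 \<Longrightarrow> y \<in> S 3 \<Longrightarrow> r 1 x = r 1 y \<Longrightarrow>
      \<gamma> x y \<in> S 6 \<and> r 2 (\<gamma> x y) = x \<and> r 3 (\<gamma> x y) = y"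
  shows "gleaf Div Cov (mk_gleaf S r \<gamma>)" (is "gleaf _ _ ?F")
proof -
  interpret bicovering_system Div Cov by (rule bicovering_system_Div)
  have section_of: "glue_by \<gamma> a b x y \<in> S c \<and> r a (glue_by \<gamma> a b x y) = x \<and> r b (glue_by \<gamma> a b x y) = y"
    if "a dvd 6" "b dvd 6" "c = lcm a b" "x \<in> S a" "y \<in> S b" "r (gcd a b) x = r (gcd a b) y"
    for a b c x y
  proof -
    consider "b dvd a" | "\<not> b dvd a" "a dvd b" | "\<not> b dvd a" "\<not> a dvd b" by blast
    then show ?thesis
    proof cases
      case 1
      then have "c = a" "gcd a b = b" using that by auto
      then show ?thesis using that 1 idt by (simp add: glue_by_def)
    next
      case 2
      then have "c = b" "gcd a b = a" using that by auto
      then show ?thesis using that 2 idt by (simp add: glue_by_def)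
    next
      case 3
      have "gcd 3 2 = (1::nat)" "gcd 2 3 = (1::nat)" "lcm 2 3 = (6::nat)" "lcm 3 2 = (6::nat)"
        by (simp_all add: lcm_nat_def)
      then show ?thesis using that 3 incomparable_divisors_6[of a b] glue
        by (auto simp: glue_by_def)
    qed
  qed
  have Cov_D: "\<exists>a b c. mn = (arr a c, arr b c) \<and> c = lcm a b \<and> a dvd c \<and> b dvd c \<and> c dvd 6 \<and> a dvd 6 \<and> b dvd 6"
    if "mn \<in> Cov" for mn using that by (cases mn) (auto elim: CovE)
  show ?thesis
  proof
    show "FOb ?F \<in> extensional (Ob Div)" by (simp add: mk_gleaf_def)
    show "small (FOb ?F c)" if "c \<in> Ob Div" for c using that small by simp
    show "FMap ?F \<in> (\<Pi>\<^sub>E f\<in>Arr Div. FOb ?F (Cod Div f) \<rightarrow>\<^sub>E FOb ?F (Dom Div f))"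
    proof (rule PiE_I)
      fix f assume "f \<in> Arr Div"
      then obtain a b where f: "f = arr a b" "a dvd b" "b dvd 6" by (auto simp: Arr_Div)
      then have "a dvd 6" by (auto intro: dvd_trans)
      then show "FMap ?F f \<in> FOb ?F (Cod Div f) \<rightarrow>\<^sub>E FOb ?F (Dom Div f)"
        using f mem by (auto simp: mk_gleaf_def)
    next
      fix f assume "f \<notin> Arr Div"
      then show "FMap ?F f = undefined" by (simp add: mk_gleaf_def)
    qed
    show "FMap ?F (Idt Div c) x = x" if "c \<in> Ob Div" "x \<in> FOb ?F c" for c x
      using that idt by simp
    show "FMap ?F (Comp Div g f) x = FMap ?F f (FMap ?F g x)"
      if "f \<in> hom Div a b" "g \<in> hom Div b c" "x \<in> FOb ?F c" for f a b g c x
    proof -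
      have *: "f = arr a b" "g = arr b c" "a dvd b" "b dvd c" "c dvd 6" "b dvd 6" "a dvd c"
        using that by (auto simp: hom_Div split: if_splits intro: dvd_trans)
      then show ?thesis using that mem comp by simp
    qed
    show "Glue ?F \<in> (\<Pi>\<^sub>E mn\<in>Cov. matching Div ?F mn \<rightarrow>\<^sub>E FOb ?F (Cod Div (fst mn)))"
    proof (rule PiE_I)
      fix mn assume mn: "mn \<in> Cov"
      obtain a b c where mn': "mn = (arr a c, arr b c)" "c = lcm a b" "a dvd c" "b dvd c" "c dvd 6"
        "a dvd 6" "b dvd 6"
        using Cov_D[OF mn] by blast
      show "Glue ?F mn \<in> matching Div ?F mn \<rightarrow>\<^sub>E FOb ?F (Cod Div (fst mn))"
      proof (rule PiE_I)
        fix xy assume "xy \<in> matching Div ?F mn"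
        then obtain x y where "xy = (x, y)" "x \<in> S a" "y \<in> S b" "r (gcd a b) x = r (gcd a b) y"
          using mn' matching_mk_gleaf[OF mn'(3-5), of S r \<gamma>] by (cases xy) (simp add: mn'(1))
        then show "Glue ?F mn xy \<in> FOb ?F (Cod Div (fst mn))"
          using mn mn' section_of[of a b c x y] by (simp add: mk_gleaf_Glue)
      next
        fix xy assume "xy \<notin> matching Div ?F mn"
        then have "\<not> (fst xy \<in> S a \<and> snd xy \<in> S b \<and> r (gcd a b) (fst xy) = r (gcd a b) (snd xy))"
          by (auto simp: mn'(1) matching_mk_gleaf[OF mn'(3-5)])
        then show "Glue ?F mn xy = undefined"
          using mn mn'(1) by (cases xy) (auto simp: mk_gleaf_def)
      qed
    next
      fix mn assume "mn \<notin> Cov"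
      then show "Glue ?F mn = undefined" by (simp add: mk_gleaf_def)
    qed
  next
    fix m n x y assume mn: "(m, n) \<in> Cov" and xy: "(x, y) \<in> matching Div ?F (m, n)"
    obtain a b c where mn': "m = arr a c" "n = arr b c" "c = lcm a b" "a dvd c" "b dvd c" "c dvd 6"
      "a dvd 6" "b dvd 6"
      using Cov_D[OF mn] by blast
    have xy': "x \<in> S a" "y \<in> S b" "r (gcd a b) x = r (gcd a b) y"
      using xy matching_mk_gleaf[OF mn'(4-6), of S r \<gamma>] by (simp_all add: mn'(1,2))
    have eq: "x = y" if "a dvd b" "b dvd a"
      using that xy' idt mn' dvd_antisym[of a b] by simp
    have "glue_by \<gamma> b a y x = glue_by \<gamma> a b x y"
      using eq incomparable_divisors_6[of a b] mn' by (auto simp: glue_by_def)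
    moreover have "(arr b c, arr a c) \<in> Cov" using mn swap mn' by simp
    ultimately show "Glue ?F (n, m) (y, x) = Glue ?F (m, n) (x, y)"
      using mn mn' xy' by (simp add: mk_gleaf_Glue gcd.commute)
  next
    fix a n x y assume A: "(Idt Div a, n) \<in> Cov" "a \<in> Ob Div" "(x, y) \<in> matching Div ?F (Idt Div a, n)"
    obtain b where n: "n = arr b a" "b dvd a" "a dvd 6"
      using Cov_D[OF A(1)] by auto
    have "x \<in> S a" "y \<in> S b" "r (gcd a b) x = r (gcd a b) y"
      using A(3) matching_mk_gleaf[OF _ n(2,3), of a S r \<gamma>] by (simp_all add: n)
    then show "Glue ?F (Idt Div a, n) (x, y) = x"
      using A n mk_gleaf_Glue[of a a b x S y r \<gamma>] by (simp add: glue_by_def)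
  next
    fix m b x y assume A: "(m, Idt Div b) \<in> Cov" "b \<in> Ob Div" "(x, y) \<in> matching Div ?F (m, Idt Div b)"
    obtain a where m: "m = arr a b" "a dvd b" "b dvd 6"
      using Cov_D[OF A(1)] by auto
    have xy: "x \<in> S a" "y \<in> S b" "r (gcd a b) x = r (gcd a b) y"
      using A(3) matching_mk_gleaf[OF m(2) _ m(3), of b S r \<gamma>] by (simp_all add: m)
    have "x = y" if "b dvd a"
      using that xy idt m dvd_antisym[of a b] by simp
    then show "Glue ?F (m, Idt Div b) (x, y) = y"
      using A m xy mk_gleaf_Glue[of a b b x S y r \<gamma>] by (simp add: glue_by_def)
  next
    fix m n p q k x y s
    assume mn: "(m, n) \<in> Cov" and pb: "is_pullback Div m n p q" and kp: "(k, p) \<in> Cov"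
      and xy: "(x, y) \<in> matching Div ?F (Comp Div m k, n)"
      and s: "s = Glue ?F (Comp Div m k, n) (x, y)"
    obtain a b c where mn': "m = arr a c" "n = arr b c" "c = lcm a b" "a dvd c" "b dvd c" "c dvd 6"
      "a dvd 6" "b dvd 6"
      using Cov_D[OF mn] by blast
    have p: "p = arr (gcd a b) a" using pb by (auto simp: is_pullback_Div mn')
    obtain a' where k: "k = arr a' a" "lcm a' (gcd a b) = a" "a' dvd a" "a' dvd 6"
      using Cov_D[OF kp] by (auto simp: p)
    have cov: "(arr a' c, arr b c) \<in> Cov"
      using Comp_bicovering[OF mn pb kp] by (simp add: mn'(1,2) k(1))
    have c: "c = lcm a' b" "a' dvd c" using cov by (simp_all add: Cov_arr)
    have xy': "x \<in> S a'" "y \<in> S b" "r (gcd a' b) x = r (gcd a' b) y"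
      using xy matching_mk_gleaf[OF c(2) mn'(5,6), of S r \<gamma>] by (simp_all add: mn'(1,2) k(1))
    have s': "s = glue_by \<gamma> a' b x y"
      using s mk_gleaf_Glue[of a' c b x S y r \<gamma>] cov xy' by (simp add: mn'(1,2) k(1))
    have sc: "s \<in> S c" "r a' s = x" "r b s = y"
      using section_of[OF k(4) mn'(8) c(1) xy'] unfolding s' by blast+
    \<comment> \<open>glueing the restrictions to \<open>a\<close> and \<open>b\<close> recovers what was glued from \<open>a'\<close> and \<open>b\<close>\<close>
have "glue_by \<gamma> a b (r a s) (r b s) = s"
    proof (cases "a dvd b \<or> b dvd a")
      case True
      then have "c = a \<and> b dvd a \<or> c = b \<and> a dvd b" using mn'(3) by auto
      then show ?thesis
        using sc idt[of c s] mn'(4-6) dvd_antisym[of a b] unfolding glue_by_def by fastforce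
    next
      case False
      then have ab: "a = 2 \<and> b = 3 \<or> a = 3 \<and> b = 2"
        using incomparable_divisors_6[of a b] mn' by blast
      then have "gcd a b = 1" by auto
      \<comment> \<open>the inner bicovering \<open>a' \<rightarrow> a \<leftarrow> 1\<close> is trivial\<close>
then have "a' = a" using k by simp
      then show ?thesis using s' sc by simp
    qed
    moreover have "r a s \<in> S a" "r b s \<in> S b" "r (gcd a b) (r a s) = r (gcd a b) (r b s)"
      using sc(1) mn'(4-6) mem comp by simp_all
    ultimately show "Glue ?F (m, n) (FMap ?F m s, FMap ?F n s) = s"
      using mn mn'(4-6) sc(1) unfolding mn'(1,2) by (simp add: mk_gleaf_Glue)
  next
    fix m' n' m n qa qb qc x y
    assume mn': "(m', n') \<in> Cov" and mn: "(m, n) \<in> Cov"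
      and mor: "bicovering_morphism Div (m', n') (m, n) qa qb qc"
      and xy: "(x, y) \<in> matching Div ?F (m, n)"
    obtain a b c where ab: "m = arr a c" "n = arr b c" "c = lcm a b" "a dvd c" "b dvd c" "c dvd 6"
      "a dvd 6" "b dvd 6"
      using Cov_D[OF mn] by blast
    obtain a' b' c' where ab': "m' = arr a' c'" "n' = arr b' c'" "c' = lcm a' b'" "a' dvd c'" "b' dvd c'"
      "c' dvd 6" "a' dvd 6" "b' dvd 6"
      using Cov_D[OF mn'] by blast
    note q = bicovering_morphism_Div[OF mor[unfolded ab(1,2) ab'(1,2)]]
    have xy': "x \<in> S a" "y \<in> S b" "r (gcd a b) x = r (gcd a b) y"
      using xy matching_mk_gleaf[OF ab(4-6), of S r \<gamma>] by (simp_all add: ab(1,2))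
    let ?s = "glue_by \<gamma> a b x y"
    have s: "?s \<in> S c" "r a ?s = x" "r b ?s = y"
      using section_of[OF ab(7,8,3) xy'] by auto
    have s': "r a' ?s = r a' x" "r b' ?s = r b' y"
      using comp[OF q(4) ab(4,6) s(1)] comp[OF q(5) ab(5,6) s(1)] s by simp_all
    have "r c' ?s = glue_by \<gamma> a' b' (r a' x) (r b' y)"
    proof (cases "a' dvd b' \<or> b' dvd a'")
      case True
      then have "c' = a' \<and> b' dvd a' \<or> c' = b' \<and> a' dvd b'" using ab'(3) by auto
      then show ?thesis using s' dvd_antisym[of a' b'] unfolding glue_by_def by fastforce
    next
      case False
      then have *: "a' = 2 \<and> b' = 3 \<or> a' = 3 \<and> b' = 2"
        using incomparable_divisors_6[of a' b'] ab' by blast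
      \<comment> \<open>a larger bicovering would have a larger intersection\<close>
      have **: "a = a'" "b = b'"
        using * q(4,5,7) ab(7,8) unfolding dvd_6_iff by auto
      then have "c' = c" using ab ab' by simp
      then show ?thesis using ** idt xy' s ab by simp
    qed
    moreover have "r a' x \<in> S a'" "r b' y \<in> S b'"
      using xy' mem q(4,5) ab(7,8) by auto
    moreover have "r (gcd a' b') (r a' x) = r (gcd a' b') (r b' y)"
      using xy' comp[of "gcd a' b'" a' a x] comp[of "gcd a' b'" b' b y] q(4,5) ab(7,8)
      by (simp add: q(7)[symmetric])
    ultimately show "FMap ?F qc (Glue ?F (m, n) (x, y)) = Glue ?F (m', n') (FMap ?F qa x, FMap ?F qb y)"
      using mn mn' ab(4-8) q(4-7) xy' s(1) unfolding ab(1,2) ab'(1,2) q(1-3)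
      by (simp add: mk_gleaf_Glue)
  qed
qed

text \<open>
  The only glueing that is not prescribed by the identity axioms.
\<close>

definition join :: "(nat, nat, 'u) gleaf \<Rightarrow> 'u \<Rightarrow> 'u \<Rightarrow> 'u" where
  "join F x y = Glue F (arr 2 6, arr 3 6) (x, y)"

lemma Cov_2_3: "(arr 2 6, arr 3 6) \<in> Cov"
  by (simp add: Cov_arr lcm_nat_def)

lemma gcd_2_3: "gcd 2 3 = (1::nat)" "gcd 3 2 = (1::nat)"
  by simp_all

lemma matching_2_3:
  "(x, y) \<in> matching Div F (arr 2 6, arr 3 6) \<longleftrightarrow>
     x \<in> FOb F 2 \<and> y \<in> FOb F 3 \<and> FMap F (arr 1 2) x = FMap F (arr 1 3) y"
  using matching_Div[of 2 6 3 F] by simp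

context
  fixes F :: "(nat, nat, 'u) gleaf"
  assumes F: "gleaf Div Cov F"
begin

interpretation gleaf Div Cov F by (rule F)

lemma res_mem: "FMap F (arr d c) x \<in> FOb F d" if "d dvd c" "c dvd 6" "x \<in> FOb F c"
  using PiE_mem[OF PiE_mem[OF FMap_PiE, of "arr d c"], of x] that by simp

lemma res_id: "FMap F (arr c c) x = x" if "c dvd 6" "x \<in> FOb F c"
  using FMap_Idt[of c x] that by simp

lemma res_comp: "FMap F (arr b d) (FMap F (arr d c) x) = FMap F (arr b c) x"
  if "b dvd d" "d dvd c" "c dvd 6" "x \<in> FOb F c"
proof -
  have "d dvd 6" using that by (auto intro: dvd_trans)
  then show ?thesis
    using FMap_Comp[of "arr b d" b d "arr d c" c x] that by (simp add: hom_Div)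
qed

lemma
  assumes "x \<in> FOb F 2" "y \<in> FOb F 3" "FMap F (arr 1 2) x = FMap F (arr 1 3) y"
  shows join_mem: "join F x y \<in> FOb F 6"
    and join_left: "FMap F (arr 2 6) (join F x y) = x"
    and join_right: "FMap F (arr 3 6) (join F x y) = y"
proof -
  have m: "(x, y) \<in> matching Div F (arr 2 6, arr 3 6)"
    using assms by (simp add: matching_2_3)
  show "join F x y \<in> FOb F 6"
    using PiE_mem[OF PiE_mem[OF Glue_PiE Cov_2_3] m] by (simp add: join_def)
  \<comment> \<open>restricting a glued element to a leg: naturality along the inclusion of that leg\<close>
  have "bicovering_morphism Div (arr 2 2, arr 1 2) (arr 2 6, arr 3 6) (arr 2 2) (arr 1 3) (arr 2 6)"
    by (rule bicovering_morphism_DivI) auto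
  from partial_naturality[OF _ Cov_2_3 this m]
  have "FMap F (arr 2 6) (join F x y) = Glue F (arr 2 2, arr 1 2) (x, FMap F (arr 1 3) y)"
    using res_id[of 2 x] assms by (simp add: join_def Cov_arr)
  also have "\<dots> = x"
    using Glue_Idt_left[of 2 "arr 1 2" x "FMap F (arr 1 3) y"] assms matching_Div[of 2 2 1 F]
      res_mem[of 1 3 y] res_id[of 1 "FMap F (arr 1 3) y"]
    by (simp add: Cov_arr)
  finally show "FMap F (arr 2 6) (join F x y) = x" .
  have "bicovering_morphism Div (arr 1 3, arr 3 3) (arr 2 6, arr 3 6) (arr 1 2) (arr 3 3) (arr 3 6)"
    by (rule bicovering_morphism_DivI) auto
  from partial_naturality[OF _ Cov_2_3 this m]
  have "FMap F (arr 3 6) (join F x y) = Glue F (arr 1 3, arr 3 3) (FMap F (arr 1 2) x, y)"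
    using res_id[of 3 y] assms by (simp add: join_def Cov_arr)
  also have "\<dots> = y"
    using Glue_Idt_right[of "arr 1 3" 3 "FMap F (arr 1 2) x" y] assms matching_Div[of 1 3 3 F]
      res_mem[of 1 2 x] res_id[of 1 "FMap F (arr 1 2) x"]
    by (simp add: Cov_arr)
  finally show "FMap F (arr 3 6) (join F x y) = y" .
qed

end

lemma gleaf_hom_mem:
  "\<eta> \<in> gleaf_hom Div Cov F G \<Longrightarrow> d dvd 6 \<Longrightarrow> x \<in> FOb F d \<Longrightarrow> \<eta> d x \<in> FOb G d"
  by (auto simp: gleaf_hom_def PiE_def Pi_def)

lemma gleaf_hom_natural:
  "\<eta> \<in> gleaf_hom Div Cov F G \<Longrightarrow> d dvd c \<Longrightarrow> c dvd 6 \<Longrightarrow> x \<in> FOb F c \<Longrightarrow>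
    \<eta> d (FMap F (arr d c) x) = FMap G (arr d c) (\<eta> c x)"
  by (auto simp: gleaf_hom_def dest!: bspec[of _ _ "arr d c"])

lemma gleaf_hom_join:
  assumes "gleaf Div Cov F" "\<eta> \<in> gleaf_hom Div Cov F G"
    "x \<in> FOb F 2" "y \<in> FOb F 3" "FMap F (arr 1 2) x = FMap F (arr 1 3) y"
  shows "\<eta> 6 (join F x y) = join G (\<eta> 2 x) (\<eta> 3 y)"
proof -
  have "(x, y) \<in> matching Div F (arr 2 6, arr 3 6)"
    using assms by (simp add: matching_2_3)
  then show ?thesis
    using assms(2) Cov_2_3 unfolding gleaf_hom_def join_def by fastforce
qed

lemma gleaf_hom_eqI:
  assumes "\<eta> \<in> gleaf_hom Div Cov F G" "\<theta> \<in> gleaf_hom Div Cov F G"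
    "\<And>d x. d dvd 6 \<Longrightarrow> x \<in> FOb F d \<Longrightarrow> \<eta> d x = \<theta> d x"
  shows "\<eta> = \<theta>"
proof -
  have P: "\<eta> \<in> (\<Pi>\<^sub>E c\<in>Ob Div. FOb F c \<rightarrow>\<^sub>E FOb G c)" "\<theta> \<in> (\<Pi>\<^sub>E c\<in>Ob Div. FOb F c \<rightarrow>\<^sub>E FOb G c)"
    using assms(1,2) by (auto simp: gleaf_hom_def)
  show ?thesis
  proof (rule PiE_ext[OF P])
    fix d assume d: "d \<in> Ob Div"
    show "\<eta> d = \<theta> d"
      by (rule PiE_ext[OF PiE_mem[OF P(1) d] PiE_mem[OF P(2) d]]) (use d assms(3) in auto)
  qed
qed

text \<open>
  Naturality takes care of the glueings along bicoverings with an identity leg; the two orders of the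
  legs of \<open>2 \<rightarrow> 6 \<leftarrow> 3\<close> are exchanged by the symmetry of glueing.
\<close>

lemma gleaf_homI:
  fixes F G :: "(nat, nat, 'u) gleaf"
  assumes F: "gleaf Div Cov F" and G: "gleaf Div Cov G"
    and mem: "\<And>d x. d dvd 6 \<Longrightarrow> x \<in> FOb F d \<Longrightarrow> h d x \<in> FOb G d"
    and nat: "\<And>d c x. d dvd c \<Longrightarrow> c dvd 6 \<Longrightarrow> x \<in> FOb F c \<Longrightarrow>
      h d (FMap F (arr d c) x) = FMap G (arr d c) (h c x)"
    and join: "\<And>x y. x \<in> FOb F 2 \<Longrightarrow> y \<in> FOb F 3 \<Longrightarrow> FMap F (arr 1 2) x = FMap F (arr 1 3) y \<Longrightarrow>
      h 6 (join F x y) = join G (h 2 x) (h 3 y)"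
  shows "(\<lambda>d\<in>Ob Div. \<lambda>x\<in>FOb F d. h d x) \<in> gleaf_hom Div Cov F G" (is "?h \<in> _")
proof -
  interpret F: gleaf Div Cov F by (rule F)
  interpret G: gleaf Div Cov G by (rule G)
  have glue: "h c (Glue F (arr a c, arr b c) (x, y)) = Glue G (arr a c, arr b c) (h a x, h b y)"
    if cov: "(arr a c, arr b c) \<in> Cov" and xy: "(x, y) \<in> matching Div F (arr a c, arr b c)"
    for a b c x y
  proof -
    have c: "c = lcm a b" "a dvd c" "b dvd c" "c dvd 6" "a dvd 6" "b dvd 6"
      using cov by (auto simp: Cov_arr)
    have xy': "x \<in> FOb F a" "y \<in> FOb F b" "FMap F (arr (gcd a b) a) x = FMap F (arr (gcd a b) b) y"
      using xy matching_Div[OF c(2-4), of F] by auto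
    have hxy: "(h a x, h b y) \<in> matching Div G (arr a c, arr b c)"
      using xy' c mem matching_Div[OF c(2-4), of G] nat[of "gcd a b" a x] nat[of "gcd a b" b y]
      by auto
    consider "b dvd a" | "a dvd b" | "a = 2" "b = 3" | "a = 3" "b = 2"
      using incomparable_divisors_6 c(5,6) by blast
    then show ?thesis
    proof cases
      case 1
      then have "c = a" using c by simp
      then show ?thesis
        using F.Glue_Idt_left[of a "arr b a" x y] G.Glue_Idt_left[of a "arr b a" "h a x" "h b y"]
          cov xy hxy c(5) by simp
    next
      case 2
      then have "c = b" using c by simp
      then show ?thesis
        using F.Glue_Idt_right[of "arr a b" b x y] G.Glue_Idt_right[of "arr a b" b "h a x" "h b y"]
          cov xy hxy c(6) by simp
    next
      case 3
      then have "c = 6" using c(1) by (simp add: lcm_nat_def)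
      then show ?thesis
        using join[of x y] xy' 3 by (simp add: join_def)
    next
      case 4
      then have "c = 6" using c(1) by (simp add: lcm_nat_def)
      then show ?thesis
        using join[of y x] xy' 4 F.Glue_swap[OF cov xy] G.Glue_swap[OF cov hxy]
        by (simp add: join_def)
    qed
  qed
  have "?h \<in> (\<Pi>\<^sub>E c\<in>Ob Div. FOb F c \<rightarrow>\<^sub>E FOb G c)"
    using mem by auto
  moreover have "?h (Dom Div f) (FMap F f x) = FMap G f (?h (Cod Div f) x)"
    if "f \<in> Arr Div" "x \<in> FOb F (Cod Div f)" for f x
  proof -
    from that obtain d c where f: "f = arr d c" "d dvd c" "c dvd 6" by (auto simp: Arr_Div)
    then have "d dvd 6" by (auto intro: dvd_trans)
    then show ?thesis using f that nat res_mem[OF F] by simp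
  qed
  moreover have "?h (Cod Div m) (Glue F (m, n) (x, y)) = Glue G (m, n) (?h (Dom Div m) x, ?h (Dom Div n) y)"
    if mn: "(m, n) \<in> Cov" "(x, y) \<in> matching Div F (m, n)" for m n x y
  proof -
    obtain a b c where m: "m = arr a c" "n = arr b c" and c: "a dvd c" "b dvd c" "c dvd 6" "a dvd 6" "b dvd 6"
      using mn(1) by (auto elim: CovE)
    have "x \<in> FOb F a" "y \<in> FOb F b"
      using mn(2) matching_Div[OF c(1-3), of F] by (auto simp: m)
    moreover have "Glue F (arr a c, arr b c) (x, y) \<in> FOb F c"
      using PiE_mem[OF PiE_mem[OF F.Glue_PiE mn(1)] mn(2)] by (simp add: m)
    ultimately show ?thesis
      using glue[of a c b x y] mn c(3-5) by (simp add: m)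
  qed
  ultimately show ?thesis
    unfolding gleaf_hom_def by blast
qed

lemma join_mk_gleaf:
  assumes "x \<in> S 2" "y \<in> S 3" "r 1 x = r 1 y"
  shows "join (mk_gleaf S r \<gamma>) x y = \<gamma> x y"
proof -
  have "Glue (mk_gleaf S r \<gamma>) (arr 2 6, arr 3 6) (x, y) = glue_by \<gamma> 2 3 x y"
    by (rule mk_gleaf_Glue) (use assms Cov_2_3 gcd_2_3 in auto)
  then show ?thesis by (simp add: join_def glue_by_def)
qed

lemma Gl_simps:
  "Ob (Gl Div Cov TYPE('u)) = {F. gleaf Div Cov F}"
  "Dom (Gl Div Cov TYPE('u)) (F, \<eta>, G) = F"
  "Cod (Gl Div Cov TYPE('u)) (F, \<eta>, G) = G"
  "(F, \<eta>, G) \<in> Arr (Gl Div Cov TYPE('u)) \<longleftrightarrow>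
     gleaf Div Cov F \<and> gleaf Div Cov G \<and> \<eta> \<in> gleaf_hom Div Cov F G"
  "(F, \<eta>, G) \<in> hom (Gl Div Cov TYPE('u)) F' G' \<longleftrightarrow>
     F = F' \<and> G = G' \<and> gleaf Div Cov F \<and> gleaf Div Cov G \<and> \<eta> \<in> gleaf_hom Div Cov F G"
  "Idt (Gl Div Cov TYPE('u)) F = (F, \<lambda>c\<in>Ob Div. \<lambda>x\<in>FOb F c. x, F)"
  "Comp (Gl Div Cov TYPE('u)) (G, \<theta>, H) (F, \<eta>, G') =
     (F, \<lambda>c\<in>Ob Div. \<lambda>x\<in>FOb F c. \<theta> c (\<eta> c x), H)"
  by (auto simp: Gl_def hom_def)

lemma Gl_Comp_eq_iff:
  fixes F :: "(nat, nat, 'u) gleaf"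
  shows "Comp (Gl Div Cov TYPE('u)) (G, \<theta>, H) (F, \<eta>, G) =
     Comp (Gl Div Cov TYPE('u)) (G', \<theta>', H) (F, \<eta>', G') \<longleftrightarrow>
     (\<forall>d. d dvd 6 \<longrightarrow> (\<forall>x\<in>FOb F d. \<theta> d (\<eta> d x) = \<theta>' d (\<eta>' d x)))" (is "?L \<longleftrightarrow> ?R")
proof
  assume ?L
  then have eq: "(\<lambda>c\<in>Ob Div. \<lambda>x\<in>FOb F c. \<theta> c (\<eta> c x)) = (\<lambda>c\<in>Ob Div. \<lambda>x\<in>FOb F c. \<theta>' c (\<eta>' c x))"
    by (simp add: Gl_simps)
  show ?R
  proof (intro allI impI ballI)
    fix d x assume "d dvd (6::nat)" "x \<in> FOb F d"
    then show "\<theta> d (\<eta> d x) = \<theta>' d (\<eta>' d x)"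
      using fun_cong[OF fun_cong[OF eq, of d], of x] by simp
  qed
next
  assume ?R
  then show ?L by (auto simp: Gl_simps intro!: restrict_ext)
qed

section \<open>Exponentials and epimorphisms\<close>

lemma (in category) product_with_terminal:
  assumes "is_terminal C t" "a \<in> Ob C" "f \<in> hom C a t"
  shows "is_product C t a a f (Idt C a)"
  unfolding is_product_def
proof (intro conjI ballI)
  fix x r s assume "x \<in> Ob C" "r \<in> hom C x t" "s \<in> hom C x a"
  then show "\<exists>!u. u \<in> hom C x a \<and> Comp C f u = r \<and> Comp C (Idt C a) u = s"
    using assms Comp_hom[of s x a f t] Comp_Idt_left unfolding is_terminal_def by metis
qed (use assms Idt_hom in auto)

text \<open>
  The functor \<open>- \<times> b\<close> preserves epimorphisms when it has a right adjoint. Here \<open>x = t \<times> b\<close>,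
  \<open>y = s \<times> b\<close> and \<open>w = \<epsilon> \<times> b\<close>; cancelling \<open>w\<close> amounts to cancelling \<open>\<epsilon>\<close> on transposes. Only the
  exponential of the one target \<open>c\<close> is involved.
\<close>

lemma (in category) exponential_product_epi:
  assumes exp: "is_exponential C b c e ev"
    and P1: "is_product C t b x p1 q1" and P2: "is_product C s b y p2 q2"
    and \<epsilon>: "\<epsilon> \<in> hom C s t"
    and epi: "\<And>h h'. h \<in> hom C t e \<Longrightarrow> h' \<in> hom C t e \<Longrightarrow> Comp C h \<epsilon> = Comp C h' \<epsilon> \<Longrightarrow> h = h'"
    and w: "w \<in> hom C y x" "Comp C p1 w = Comp C \<epsilon> p2" "Comp C q1 w = q2"
    and f: "f \<in> hom C x c" "f' \<in> hom C x c" "Comp C f w = Comp C f' w"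
  shows "f = f'"
proof -
  obtain d p q where d: "is_product C e b d p q" and ev: "ev \<in> hom C d c"
    and univ_all: "\<forall>a d' p' q' f. is_product C a b d' p' q' \<and> a \<in> Ob C \<and> f \<in> hom C d' c \<longrightarrow>
      (\<exists>!h. h \<in> hom C a e \<and>
        (\<exists>w\<in>hom C d' d. Comp C p w = Comp C h p' \<and> Comp C q w = q' \<and> Comp C ev w = f))"
    using exp unfolding is_exponential_def by (elim exE conjE)
  note univ = univ_all[rule_format, OF conjI, OF _ conjI]
  have st: "s \<in> Ob C" "t \<in> Ob C"
    using \<epsilon> Dom_Ob Cod_Ob by (auto simp: hom_def)
  have x: "x \<in> Ob C" "p1 \<in> hom C x t" "q1 \<in> hom C x b"
    and y: "y \<in> Ob C" "p2 \<in> hom C y s" "q2 \<in> hom C y b"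
    and pq: "p \<in> hom C d e" "q \<in> hom C d b"
    using P1 P2 d unfolding is_product_def by auto
  obtain h v where h: "h \<in> hom C t e" "v \<in> hom C x d" "Comp C p v = Comp C h p1"
    "Comp C q v = q1" "Comp C ev v = f"
    using univ[OF P1 st(2) f(1)] by blast
  obtain h' v' where h': "h' \<in> hom C t e" "v' \<in> hom C x d" "Comp C p v' = Comp C h' p1"
    "Comp C q v' = q1" "Comp C ev v' = f'"
    using univ[OF P1 st(2) f(2)] by blast
  \<comment> \<open>both composites with \<open>\<epsilon>\<close> are the transpose of the same arrow\<close>
  have transpose: "Comp C k \<epsilon> \<in> hom C s e \<and>
      (\<exists>w'\<in>hom C y d. Comp C p w' = Comp C (Comp C k \<epsilon>) p2 \<and> Comp C q w' = q2 \<and>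
         Comp C ev w' = Comp C g w)"
    if "k \<in> hom C t e" "u \<in> hom C x d" "Comp C p u = Comp C k p1" "Comp C q u = q1" "Comp C ev u = g"
    for k u g
  proof (intro conjI bexI)
    show "Comp C k \<epsilon> \<in> hom C s e" "Comp C u w \<in> hom C y d"
      using Comp_hom \<epsilon> w(1) that(1,2) by auto
    show "Comp C p (Comp C u w) = Comp C (Comp C k \<epsilon>) p2"
      using Comp_assoc[OF w(1) that(2) pq(1)] Comp_assoc[OF w(1) x(2) that(1)]
        Comp_assoc[OF y(2) \<epsilon> that(1)] that(3) w(2) by simp
    show "Comp C q (Comp C u w) = q2"
      using Comp_assoc[OF w(1) that(2) pq(2)] that(4) w(3) by simp
    show "Comp C ev (Comp C u w) = Comp C g w"
      using Comp_assoc[OF w(1) that(2) ev] that(5) by simp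
  qed
  have "Comp C h \<epsilon> = Comp C h' \<epsilon>"
    using univ[OF P2 st(1) Comp_hom[OF w(1) f(1)]] transpose[OF h] transpose[OF h'] f(3) by auto
  then have "h = h'" using epi h h' by blast
  then have "v = v'"
    using d h h' x Comp_hom[OF x(2) h(1)] unfolding is_product_def by metis
  then show ?thesis using h h' by simp
qed

text \<open>
  Away from the top, the glueing of the restrictions of \<open>x\<close> cannot be distinguished from \<open>x\<close>: every
  proper divisor of \<open>6\<close> lies below a leg.
\<close>

lemma
  assumes F: "gleaf Div Cov F" and x: "x \<in> FOb F 6"
  shows join_res_mem: "join F (FMap F (arr 2 6) x) (FMap F (arr 3 6) x) \<in> FOb F 6" (is "?j \<in> _")
    and join_res: "e dvd 6 \<Longrightarrow> e \<noteq> 6 \<Longrightarrow>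
      FMap F (arr e 6) (join F (FMap F (arr 2 6) x) (FMap F (arr 3 6) x)) = FMap F (arr e 6) x"
proof -
  have m: "FMap F (arr 2 6) x \<in> FOb F 2" "FMap F (arr 3 6) x \<in> FOb F 3"
    "FMap F (arr 1 2) (FMap F (arr 2 6) x) = FMap F (arr 1 3) (FMap F (arr 3 6) x)"
    using res_mem[OF F] res_comp[OF F] x by simp_all
  note j = join_mem[OF F m] join_left[OF F m] join_right[OF F m]
  show "?j \<in> FOb F 6" by (rule j)
  assume "e dvd 6" "e \<noteq> 6"
  then have "e dvd 2 \<or> e dvd 3" unfolding dvd_6_iff by auto
  then show "FMap F (arr e 6) ?j = FMap F (arr e 6) x"
  proof
    assume "e dvd 2"
    then show ?thesis using res_comp[OF F, of e 2 6 ?j] res_comp[OF F, of e 2 6 x] j x by simp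
  next
    assume "e dvd 3"
    then show ?thesis using res_comp[OF F, of e 3 6 ?j] res_comp[OF F, of e 3 6 x] j x by simp
  qed
qed

section \<open>Free gleaves\<close>

text \<open>
  An infinite type contains copies of the natural numbers, which name the elements of the gleaves
  constructed below.
\<close>

definition code :: "nat \<Rightarrow> 'u" where
  "code = (SOME f. inj f)"

definition one :: "(nat, nat, 'u) gleaf" where
  "one = mk_gleaf (\<lambda>_. {code 0}) (\<lambda>_ x. x) (\<lambda>_ _. code 0)"

text \<open>
  The elements over \<open>2\<close> and \<open>3\<close> are their own restrictions to \<open>1\<close>. As these differ, there is no
  matching pair and nothing needs to be glued.
\<close>

definition pieces :: "(nat, nat, 'u) gleaf" where
  "pieces = mk_gleaf
     (\<lambda>d. if d = 1 then {code 0, code 1} else if d = 2 then {code 0} else if d = 3 then {code 1} else {})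
     (\<lambda>_ x. x) (\<lambda>_ _. code 0)"

text \<open>
  The free gleaf on a generator over \<open>d\<close>. Below \<open>6\<close> it is the representable presheaf. Over \<open>6\<close> the
  free gleaf on a generator \<open>code 1\<close> has the second element \<open>code 0\<close>, the glueing of the
  restrictions of the generator.
\<close>

definition free :: "nat \<Rightarrow> (nat, nat, 'u) gleaf" where
  "free d = mk_gleaf
     (\<lambda>c. if c dvd d then if c = 6 then {code 0, code 1} else {code 0} else {})
     (\<lambda>c x. if c = 6 then x else code 0) (\<lambda>_ _. code 0)"

definition gen :: "nat \<Rightarrow> 'u" where
  "gen d = (if d = 6 then code 1 else code 0)"

text \<open>
  The morphism from the free gleaf that sends the generator to \<open>x\<close>.
\<close>

definition yoneda :: "(nat, nat, 'u) gleaf \<Rightarrow> nat \<Rightarrow> 'u \<Rightarrow> nat \<Rightarrow> 'u \<Rightarrow> 'u" where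
  "yoneda F d x = (\<lambda>c\<in>Ob Div. \<lambda>v\<in>FOb (free d) c.
     if c = 6 \<and> v = code 0 then join F (FMap F (arr 2 6) x) (FMap F (arr 3 6) x)
     else FMap F (arr c d) x)"

text \<open>
  Over every divisor, \<open>code 0\<close> is the element of the terminal gleaf; in the free gleaf on a generator
  over \<open>6\<close> these elements form a copy of the terminal gleaf. So this formula gives morphisms
  into both.
\<close>

definition collapse :: "(nat, nat, 'u) gleaf \<Rightarrow> nat \<Rightarrow> 'u \<Rightarrow> 'u" where
  "collapse F = (\<lambda>c\<in>Ob Div. \<lambda>v\<in>FOb F c. code 0)"

context
  assumes inf: "infinite (UNIV :: 'u set)"
begin

lemma code_eq_iff [simp]: "(code i :: 'u) = code j \<longleftrightarrow> i = j"
proof -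
  have "\<exists>f :: nat \<Rightarrow> 'u. inj f"
    using infinite_countable_subset[OF inf] by auto
  then have "inj (code :: nat \<Rightarrow> 'u)" unfolding code_def by (rule someI_ex)
  then show ?thesis by (simp add: inj_eq)
qed

lemma small_finite: "finite A \<Longrightarrow> small (A :: 'u set)"
  using inf by (simp add: small_def finite_lesspoll_infinite)

lemma gleaf_one: "gleaf Div Cov (one :: (nat, nat, 'u) gleaf)"
  unfolding one_def by (rule gleaf_mk_gleaf) (auto intro: small_finite)

lemma gleaf_pieces: "gleaf Div Cov (pieces :: (nat, nat, 'u) gleaf)"
  unfolding pieces_def
proof (rule gleaf_mk_gleaf, goal_cases)
  case (2 d c x)
  then have "d dvd 6" by (auto intro: dvd_trans)
  then show ?case using 2 unfolding dvd_6_iff by (auto split: if_splits)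
next
  case (5 x y)
  then show ?case by simp
qed (simp_all add: small_finite)

lemma gleaf_free:
  assumes d: "d dvd 6"
  shows "gleaf Div Cov (free d :: (nat, nat, 'u) gleaf)"
  unfolding free_def
proof (rule gleaf_mk_gleaf, goal_cases)
  case (2 b c x)
  then have "c dvd d" "b dvd d" by (auto split: if_splits dest: dvd_trans)
  moreover have "c = 6" if "b = 6" using that 2 dvd_antisym by blast
  ultimately show ?case using 2 by auto
next
  case (4 a b c x)
  have "b = 6" if "a = 6" using that 4 dvd_trans dvd_antisym by blast
  then show ?case by simp
next
  case (5 x y)
  then have "2 dvd d" "3 dvd d" by (auto split: if_splits)
  then have "d = 6" using d unfolding dvd_6_iff by auto
  then show ?case using 5 by simp
next
  case (3 c x)
  then show ?case by (simp split: if_splits)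
qed (simp add: small_finite)

lemma FOb_free:
  "c dvd 6 \<Longrightarrow> FOb (free d :: (nat, nat, 'u) gleaf) c =
    (if c dvd d then if c = 6 then {code 0, code 1} else {code 0} else {})"
  by (simp add: free_def)

lemma FMap_free:
  assumes "e dvd c" "c dvd 6" "x \<in> FOb (free d :: (nat, nat, 'u) gleaf) c"
  shows "FMap (free d) (arr e c) x = (if e = 6 then x else code 0)"
  using assms unfolding free_def by simp

lemma gen_in_free: "d dvd 6 \<Longrightarrow> (gen d :: 'u) \<in> FOb (free d) d"
  by (simp add: FOb_free gen_def)

lemma yoneda_hom:
  assumes F: "gleaf Div Cov F" and d: "d dvd 6" and x: "x \<in> FOb F d"
  shows "yoneda F d x \<in> gleaf_hom Div Cov (free d) (F :: (nat, nat, 'u) gleaf)"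
  unfolding yoneda_def
proof (rule gleaf_homI[OF gleaf_free[OF d] F], goal_cases)
  case (1 c v)
  then have "c dvd d" by (auto simp: FOb_free split: if_splits)
  then show ?case
    using res_mem[OF F _ d x] join_res_mem[OF F, of x] d x dvd_antisym[of d c] 1 by auto
next
  case (2 e c v)
  then have c: "c dvd d" "e dvd d" by (auto simp: FOb_free split: if_splits intro: dvd_trans)
  have e: "e dvd 6" using dvd_trans[OF 2(1,2)] .
  show ?case
  proof (cases "e = 6")
    case True
    then have "c = 6" "d = 6" using 2 c d dvd_antisym by auto
    then show ?thesis
      using True 2 x res_id[OF F, of 6] join_res_mem[OF F, of x] by (simp add: FMap_free)
  next
    case e6: False
    show ?thesis
    proof (cases "c = 6")
      case True
      then have "d = 6" using c d dvd_antisym by auto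
      then show ?thesis
        using True e6 e 2 x join_res[OF F _ e e6, of x] res_comp[OF F, of e 6 6 x]
        by (simp add: FMap_free)
    next
      case False
      then show ?thesis
        using e6 2 x d c res_comp[OF F, of e c d x] by (simp add: FMap_free)
    qed
  qed
next
  case (3 u v)
  then have "2 dvd d" "3 dvd d" by (auto simp: FOb_free split: if_splits)
  then have d6: "d = 6" using d unfolding dvd_6_iff by auto
  have "u = code 0" "v = code 0" using 3 by (auto simp: FOb_free split: if_splits)
  moreover have "join (free d) (code 0) (code 0) = (code 0 :: 'u)"
    unfolding free_def by (subst join_mk_gleaf) (auto simp: d6)
  ultimately show ?case by (simp add: d6)
qed

lemma yoneda_gen:
  assumes "gleaf Div Cov F" "d dvd 6" "x \<in> FOb F d"
  shows "yoneda F d x d (gen d :: 'u) = x"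
  using assms res_id[OF assms] gen_in_free[OF assms(2)] by (simp add: yoneda_def gen_def)

lemma yoneda_unique:
  fixes G :: "(nat, nat, 'u) gleaf"
  assumes G: "gleaf Div Cov G" and d: "d dvd 6" and \<eta>: "\<eta> \<in> gleaf_hom Div Cov (free d) G"
  shows "\<eta> = yoneda G d (\<eta> d (gen d))"
proof (rule gleaf_hom_eqI[OF \<eta>])
  let ?x = "\<eta> d (gen d)"
  have x: "?x \<in> FOb G d"
    using gleaf_hom_mem[OF \<eta> d gen_in_free[OF d]] .
  show "yoneda G d ?x \<in> gleaf_hom Div Cov (free d) G"
    by (rule yoneda_hom[OF G d x])
  have res: "\<eta> c (code 0) = FMap G (arr c d) ?x" if "c dvd d" "c \<noteq> 6" for c
    using gleaf_hom_natural[OF \<eta> that(1) d gen_in_free[OF d]] that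
      FMap_free[OF that(1) d gen_in_free[OF d]] by simp
  fix c and v :: 'u assume c: "c dvd 6" and v: "v \<in> FOb (free d) c"
  have cd: "c dvd d" using v c by (auto simp: FOb_free split: if_splits)
  show "\<eta> c v = yoneda G d ?x c v"
  proof (cases "c = 6")
    case False
    then have "v = code 0" using v c by (auto simp: FOb_free split: if_splits)
    then show ?thesis using False c v cd res by (simp add: yoneda_def)
  next
    case c6: True
    then have d6: "d = 6" using cd d dvd_antisym by auto
    show ?thesis
    proof (cases "v = code 0")
      case True
      have in23: "(code 0 :: 'u) \<in> FOb (free 6) 2" "(code 0 :: 'u) \<in> FOb (free 6) 3"
        by (simp_all add: FOb_free)
      have j: "join (free 6) (code 0) (code 0) = (code 0 :: 'u)"
        unfolding free_def by (subst join_mk_gleaf) auto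
      have "\<eta> 6 (join (free 6) (code 0) (code 0)) = join G (\<eta> 2 (code 0)) (\<eta> 3 (code 0))"
        by (rule gleaf_hom_join[OF gleaf_free _ in23])
          (use \<eta> d6 in23 FMap_free[of 1 2 "code 0" 6] FMap_free[of 1 3 "code 0" 6] in auto)
      then show ?thesis
        using True c6 d6 v res[of 2] res[of 3] by (simp add: j yoneda_def)
    next
      case False
      then have "v = gen d" using v c6 d6 by (auto simp: FOb_free gen_def)
      then show ?thesis using c6 d6 yoneda_gen[OF G d x] by simp
    qed
  qed
qed

text \<open>
  Elements are morphisms out of free gleaves, so a monomorphism separates them.
\<close>

lemma monic_Gl_inj:
  fixes F G :: "(nat, nat, 'u) gleaf"
  assumes m: "monic (Gl Div Cov TYPE('u)) (F, \<mu>, G)"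
    and d: "d dvd 6" and x: "x \<in> FOb F d" and y: "y \<in> FOb F d" and eq: "\<mu> d x = \<mu> d y"
  shows "x = y"
proof -
  have FG: "gleaf Div Cov F" "gleaf Div Cov G" "\<mu> \<in> gleaf_hom Div Cov F G"
    using m by (auto simp: monic_def Gl_simps)
  have comp: "Comp (Gl Div Cov TYPE('u)) (F, \<mu>, G) (free d, yoneda F d z, F) =
      (free d, yoneda G d (\<mu> d z), G)" if z: "z \<in> FOb F d" for z
  proof -
    let ?\<eta> = "\<lambda>c\<in>Ob Div. \<lambda>x\<in>FOb (free d) c. \<mu> c (yoneda F d z c x)"
    have "?\<eta> \<in> gleaf_hom Div Cov (free d) G"
      by (rule gleaf_hom_Comp[OF gleaf_free[OF d] yoneda_hom[OF FG(1) d z] FG(3)])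
    from yoneda_unique[OF FG(2) d this] show ?thesis
      using d gen_in_free[OF d] yoneda_gen[OF FG(1) d z] by (simp add: Gl_simps)
  qed
  have hom: "(free d, yoneda F d z, F) \<in> hom (Gl Div Cov TYPE('u)) (free d) F"
    if "z \<in> FOb F d" for z
    using FG(1) gleaf_free[OF d] yoneda_hom[OF FG(1) d that] by (simp add: Gl_simps)
  have "free d \<in> Ob (Gl Div Cov TYPE('u))"
    using gleaf_free[OF d] by (simp add: Gl_simps)
  then have "(free d :: (nat, nat, 'u) gleaf, yoneda F d x, F) = (free d, yoneda F d y, F)"
    using m hom[OF x] hom[OF y] comp[OF x] comp[OF y] eq
    unfolding monic_def Gl_simps(2) by metis
  then show ?thesis
    using yoneda_gen[OF FG(1) d] x y by (metis prod.inject)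
qed

lemma collapse_one:
  assumes F: "gleaf Div Cov F"
  shows "collapse F \<in> gleaf_hom Div Cov F (one :: (nat, nat, 'u) gleaf)"
  unfolding collapse_def by (rule gleaf_homI[OF F gleaf_one]) (simp_all add: one_def join_mk_gleaf)

lemma collapse_free_6:
  assumes F: "gleaf Div Cov F"
  shows "collapse F \<in> gleaf_hom Div Cov F (free 6 :: (nat, nat, 'u) gleaf)"
  unfolding collapse_def
proof (rule gleaf_homI[OF F gleaf_free[OF dvd_refl]], goal_cases)
  case (2 d c x)
  then show ?case by (simp add: FMap_free FOb_free)
next
  case (3 x y)
  show ?case unfolding free_def by (subst join_mk_gleaf) auto
qed (simp add: FOb_free)

lemma terminal_one: "is_terminal (Gl Div Cov TYPE('u)) one"
  unfolding is_terminal_def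
proof (intro conjI ballI)
  show "one \<in> Ob (Gl Div Cov TYPE('u))" by (simp add: Gl_simps gleaf_one)
  fix F assume "F \<in> Ob (Gl Div Cov TYPE('u))"
  then have F: "gleaf Div Cov F" by (simp add: Gl_simps)
  have "\<eta> = collapse F" if "\<eta> \<in> gleaf_hom Div Cov F one" for \<eta>
    using that collapse_one[OF F]
    by (rule gleaf_hom_eqI)
      (use gleaf_hom_mem[OF that] gleaf_hom_mem[OF collapse_one[OF F]] in \<open>auto simp: one_def\<close>)
  then show "\<exists>!f. f \<in> hom (Gl Div Cov TYPE('u)) F one"
    using F gleaf_one collapse_one[OF F] by (auto simp: hom_Gl)
qed

section \<open>Failure of cartesian closedness\<close>

text \<open>
  The two arrows to be told apart are the identity of \<open>X\<close> and \<open>collapse X\<close>, both from \<open>X\<close> to \<open>X\<close>, where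
  \<open>X\<close> is free on an element over \<open>6\<close>. They differ at the generator only.
\<close>

lemma not_cartesian_closed: "\<not> cartesian_closed (Gl Div Cov TYPE('u))"
proof
  let ?G = "Gl Div Cov TYPE('u)"
  interpret category ?G by (rule category_Gl)
  let ?X = "free 6 :: (nat, nat, 'u) gleaf"
  have X: "gleaf Div Cov ?X" by (rule gleaf_free) simp
  have XO: "?X \<in> Ob ?G" using X by (simp add: Gl_simps)
  note P = gleaf_pieces
  let ?\<epsilon> = "(pieces, collapse pieces, one)"
  let ?\<psi> = "(pieces, collapse pieces, ?X)"
  assume "cartesian_closed ?G"
  then obtain E ev where exp: "is_exponential ?G ?X ?X E ev"
    using XO unfolding cartesian_closed_def by blast
  have bang: "(?X, collapse ?X, one) \<in> hom ?G ?X one"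
    using X gleaf_one collapse_one[OF X] by (simp add: Gl_simps)
  have P1: "is_product ?G one ?X ?X (?X, collapse ?X, one) (Idt ?G ?X)"
    by (rule product_with_terminal[OF terminal_one _ bang]) (simp add: Gl_simps X)
  have \<psi>: "?\<psi> \<in> hom ?G pieces ?X"
    using X P collapse_free_6[OF P] by (simp add: Gl_simps)
  have \<epsilon>: "?\<epsilon> \<in> hom ?G pieces one"
    using gleaf_one P collapse_one[OF P] by (simp add: Gl_simps)
  \<comment> \<open>a gleaf over \<open>pieces\<close> is empty over \<open>6\<close>, so it has exactly one morphism to \<open>X\<close>\<close>
have P2: "is_product ?G pieces ?X pieces (Idt ?G pieces) ?\<psi>"
    unfolding is_product_def
  proof (intro conjI ballI)
    show "pieces \<in> Ob ?G" "Idt ?G pieces \<in> hom ?G pieces pieces" "?\<psi> \<in> hom ?G pieces ?X"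
      using \<psi> P Idt_hom by (auto simp: Gl_simps(1))
    fix T r s assume T: "T \<in> Ob ?G" and r: "r \<in> hom ?G T pieces" and s: "s \<in> hom ?G T ?X"
    obtain \<rho> \<sigma> where rs: "r = (T, \<rho>, pieces)" "s = (T, \<sigma>, ?X)"
      "\<rho> \<in> gleaf_hom Div Cov T pieces" "\<sigma> \<in> gleaf_hom Div Cov T ?X" "gleaf Div Cov T"
      using r s by (auto simp: hom_Gl)
    have hs: "(\<lambda>c\<in>Ob Div. \<lambda>x\<in>FOb T c. collapse pieces c (\<rho> c x)) \<in> gleaf_hom Div Cov T ?X"
      by (rule gleaf_hom_Comp[OF rs(5,3) collapse_free_6[OF P]])
    have "(\<lambda>c\<in>Ob Div. \<lambda>x\<in>FOb T c. collapse pieces c (\<rho> c x)) = \<sigma>"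
    proof (rule gleaf_hom_eqI[OF hs rs(4)])
      fix d x assume d: "d dvd 6" and x: "x \<in> FOb T d"
      have "\<rho> d x \<in> FOb pieces d" "\<sigma> d x \<in> FOb ?X d"
        using gleaf_hom_mem[OF rs(3) d x] gleaf_hom_mem[OF rs(4) d x] by simp_all
      then show "(\<lambda>c\<in>Ob Div. \<lambda>x\<in>FOb T c. collapse pieces c (\<rho> c x)) d x = \<sigma> d x"
        using d x by (auto simp: collapse_def FOb_free pieces_def split: if_splits)
    qed
    then have "Comp ?G ?\<psi> r = s" by (simp add: rs Gl_simps)
    then show "\<exists>!u. u \<in> hom ?G T pieces \<and> Comp ?G (Idt ?G pieces) u = r \<and> Comp ?G ?\<psi> u = s"
      using r Comp_Idt_left by metis
  qed
  \<comment> \<open>the element over \<open>6\<close> of the terminal gleaf is glued from elements hit by \<open>pieces\<close>\<close>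
have epi: "h = h'" if h: "h \<in> hom ?G one E" "h' \<in> hom ?G one E"
    and eq: "Comp ?G h ?\<epsilon> = Comp ?G h' ?\<epsilon>" for h h'
  proof -
    obtain \<eta> \<eta>' where \<eta>: "h = (one, \<eta>, E)" "h' = (one, \<eta>', E)" "gleaf Div Cov E"
      "\<eta> \<in> gleaf_hom Div Cov one E" "\<eta>' \<in> gleaf_hom Div Cov one E"
      using h by (auto simp: hom_Gl)
    have low: "\<eta> d (code 0) = \<eta>' d (code 0)" if d: "d \<in> {1, 2, 3}" for d
    proof -
      from d have "d dvd 6" unfolding dvd_6_iff by auto
      moreover from d have "\<exists>x. x \<in> FOb (pieces :: (nat, nat, 'u) gleaf) d"
        unfolding pieces_def by auto
      ultimately show ?thesis
        using eq unfolding \<eta>(1,2) Gl_Comp_eq_iff by (auto simp: collapse_def)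
    qed
    have j: "join one (code 0) (code 0) = (code 0 :: 'u)"
      unfolding one_def by (rule join_mk_gleaf) auto
    have j6: "\<theta> 6 (code 0) = join E (\<theta> 2 (code 0)) (\<theta> 3 (code 0))"
      if "\<theta> \<in> gleaf_hom Div Cov one E" for \<theta>
      using gleaf_hom_join[OF gleaf_one that, of "code 0" "code 0"] unfolding j
      by (simp add: one_def)
    have top: "\<eta> 6 (code 0) = \<eta>' 6 (code 0)"
      unfolding j6[OF \<eta>(4)] j6[OF \<eta>(5)] using low[of 2] low[of 3] by simp
    have "\<eta> = \<eta>'"
    proof (rule gleaf_hom_eqI[OF \<eta>(4,5)])
      fix d and x :: 'u assume d: "d dvd 6" and x: "x \<in> FOb one d"
      have "d \<in> {1, 2, 3} \<or> d = 6" using d unfolding dvd_6_iff by auto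
      moreover have "x = code 0" using d x by (simp add: one_def)
      ultimately show "\<eta> d x = \<eta>' d x" using low top by auto
    qed
    then show ?thesis by (simp add: \<eta>)
  qed
  have "Idt ?G ?X = (?X, collapse ?X, ?X)"
  proof (rule exponential_product_epi[OF exp P1 P2 \<epsilon> epi \<psi>])
    show "Comp ?G (?X, collapse ?X, one) ?\<psi> = Comp ?G ?\<epsilon> (Idt ?G pieces)"
      using terminal_one P Comp_hom[OF \<psi> bang] Comp_Idt_right[OF \<epsilon>] \<epsilon>
      unfolding is_terminal_def by (auto simp: Gl_simps(1))
    show "Comp ?G (Idt ?G ?X) ?\<psi> = ?\<psi>" by (rule Comp_Idt_left[OF \<psi>])
    show "Idt ?G ?X \<in> hom ?G ?X ?X" using X Idt_hom by (simp add: Gl_simps(1))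
    show "(?X, collapse ?X, ?X) \<in> hom ?G ?X ?X"
      using X collapse_free_6[OF X] by (simp add: Gl_simps)
    show "Comp ?G (Idt ?G ?X) ?\<psi> = Comp ?G (?X, collapse ?X, ?X) ?\<psi>"
      unfolding Gl_simps(6) Gl_Comp_eq_iff
      by (auto simp: collapse_def FOb_free)
  qed
  then have "(\<lambda>c\<in>Ob Div. \<lambda>x\<in>FOb ?X c. x) 6 (code 1) = collapse ?X 6 (code 1)"
    by (simp add: Gl_simps)
  then show False by (simp add: collapse_def FOb_free)
qed

end

section \<open>Sieves and the subobject classifier\<close>

definition sieves :: "nat \<Rightarrow> nat set set" where
  "sieves d = {S. S \<subseteq> {e. e dvd d} \<and> (\<forall>a\<in>S. \<forall>b. b dvd a \<longrightarrow> b \<in> S)}"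

definition enc :: "nat set \<Rightarrow> 'u" where
  "enc S = code (set_encode S)"

definition dec :: "'u \<Rightarrow> nat set" where
  "dec x = set_decode (inv code x)"

text \<open>
  In the glueing, a divisor \<open>d\<close> of \<open>6\<close> is the least common multiple of \<open>gcd d 2\<close> and \<open>gcd d 3\<close>, so an
  element glued from \<open>y\<close> and \<open>z\<close> restricts over \<open>d\<close> to the glueing of their restrictions to
  these two. It lies in a subgleaf iff both of them do.
\<close>

definition omega :: "(nat, nat, 'u) gleaf" where
  "omega = mk_gleaf (\<lambda>d. enc ` sieves d) (\<lambda>d x. enc (dec x \<inter> {e. e dvd d}))
     (\<lambda>x y. enc {d. d dvd 6 \<and> gcd d 2 \<in> dec x \<and> gcd d 3 \<in> dec y})"

definition truth :: "nat \<Rightarrow> 'u \<Rightarrow> 'u" where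
  "truth = (\<lambda>d\<in>Ob Div. \<lambda>x\<in>FOb one d. enc {e. e dvd d})"

definition char_map ::
  "(nat, nat, 'u) gleaf \<Rightarrow> (nat \<Rightarrow> 'u \<Rightarrow> 'u) \<Rightarrow> (nat, nat, 'u) gleaf \<Rightarrow> nat \<Rightarrow> 'u \<Rightarrow> 'u" where
  "char_map F \<mu> G = (\<lambda>d\<in>Ob Div. \<lambda>y\<in>FOb G d.
     enc {e. e dvd d \<and> FMap G (arr e d) y \<in> \<mu> e ` FOb F e})"

lemma finite_divisors: "d dvd 6 \<Longrightarrow> finite {e::nat. e dvd d}"
proof (rule finite_subset)
  assume "d dvd 6"
  then show "{e. e dvd d} \<subseteq> {1, 2, 3, 6}"
    using dvd_trans[of _ d 6] unfolding dvd_6_iff by blast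
qed simp

lemma sieve_finite: "d dvd 6 \<Longrightarrow> S \<in> sieves d \<Longrightarrow> finite S"
  using finite_divisors finite_subset unfolding sieves_def by blast

lemma sieve_down: "S \<in> sieves d \<Longrightarrow> a \<in> S \<Longrightarrow> b dvd a \<Longrightarrow> b \<in> S"
  unfolding sieves_def by blast

lemma sieve_dvd: "S \<in> sieves d \<Longrightarrow> a \<in> S \<Longrightarrow> a dvd d"
  unfolding sieves_def by blast

lemma sieve_restrict: "d dvd c \<Longrightarrow> S \<in> sieves c \<Longrightarrow> S \<inter> {e. e dvd d} \<in> sieves d"
  unfolding sieves_def using dvd_trans by blast

lemma sieve_top: "{e. e dvd d} \<in> sieves d"
  unfolding sieves_def using dvd_trans by blast

lemma sieve_join:
  assumes "S \<in> sieves 2" "T \<in> sieves 3"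
  shows "{d. d dvd 6 \<and> gcd d 2 \<in> S \<and> gcd d 3 \<in> T} \<in> sieves 6" (is "?U \<in> _")
proof -
  have "b \<in> ?U" if "a \<in> ?U" "b dvd a" for a b
    using that sieve_down[OF assms(1), of "gcd a 2" "gcd b 2"]
      sieve_down[OF assms(2), of "gcd a 3" "gcd b 3"] gcd_mono[OF that(2) dvd_refl]
      dvd_trans[OF that(2)] by simp
  then show ?thesis unfolding sieves_def by blast
qed

text \<open>
  A sieve on \<open>2\<close> or \<open>3\<close> is nonempty iff it contains \<open>1\<close>. So if the two sieves agree at \<open>1\<close>, the condition
  on the other leg is void for divisors of one leg.
\<close>

lemma sieve_join_restrict:
  assumes S: "S \<in> sieves 2" and T: "T \<in> sieves 3" and eq: "S \<inter> {e. e dvd 1} = T \<inter> {e. e dvd 1}"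
  shows "{d. d dvd 6 \<and> gcd d 2 \<in> S \<and> gcd d 3 \<in> T} \<inter> {e. e dvd 2} = S" (is "?U \<inter> _ = _")
    and "{d. d dvd 6 \<and> gcd d 2 \<in> S \<and> gcd d 3 \<in> T} \<inter> {e. e dvd 3} = T"
proof -
  have one: "1 \<in> S" if "e \<in> S" for e using sieve_down[OF S that] by simp
  have one': "1 \<in> T" if "e \<in> T" for e using sieve_down[OF T that] by simp
  have 11: "1 \<in> S \<longleftrightarrow> 1 \<in> T" using arg_cong[OF eq, of "\<lambda>X. 1 \<in> X"] by simp
  have g2: "gcd e 2 = e \<and> gcd e 3 = 1 \<and> e dvd 6" if "e dvd 2" for e :: nat
  proof -
    have "e dvd 6" using that by (rule dvd_trans) simp
    then have "e = 1 \<or> e = 2" using that unfolding dvd_6_iff by auto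
    then show ?thesis by auto
  qed
  have g3: "gcd e 3 = e \<and> gcd e 2 = 1 \<and> e dvd 6" if "e dvd 3" for e :: nat
  proof -
    have "e dvd 6" using that by (rule dvd_trans) simp
    then have "e = 1 \<or> e = 3" using that unfolding dvd_6_iff by auto
    then show ?thesis by auto
  qed
  show "?U \<inter> {e. e dvd 2} = S"
  proof (intro set_eqI iffI)
    fix e assume "e \<in> ?U \<inter> {e. e dvd 2}"
    then show "e \<in> S" using g2[of e] by auto
  next
    fix e assume "e \<in> S"
    then show "e \<in> ?U \<inter> {e. e dvd 2}"
      using g2[of e] sieve_dvd[OF S, of e] one[of e] 11 by simp
  qed
  show "?U \<inter> {e. e dvd 3} = T"
  proof (intro set_eqI iffI)
    fix e assume "e \<in> ?U \<inter> {e. e dvd 3}"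
    then show "e \<in> T" using g3[of e] by auto
  next
    fix e assume "e \<in> T"
    then show "e \<in> ?U \<inter> {e. e dvd 3}"
      using g3[of e] sieve_dvd[OF T, of e] one'[of e] 11 by simp
  qed
qed

context
  assumes inf: "infinite (UNIV :: 'u set)"
begin

lemma dec_enc: "d dvd 6 \<Longrightarrow> S \<in> sieves d \<Longrightarrow> dec (enc S :: 'u) = S"
proof -
  assume "d dvd 6" "S \<in> sieves d"
  then have "finite S" by (rule sieve_finite)
  moreover have "inj (code :: nat \<Rightarrow> 'u)" using code_eq_iff[OF inf] by (simp add: inj_def)
  ultimately show ?thesis by (simp add: dec_def enc_def)
qed

lemma enc_eq_iff:
  assumes "d dvd 6" "S \<in> sieves d" "T \<in> sieves d"
  shows "(enc S :: 'u) = enc T \<longleftrightarrow> S = T"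
proof
  assume "(enc S :: 'u) = enc T"
  then have "dec (enc S :: 'u) = dec (enc T :: 'u)" by (rule arg_cong)
  then show "S = T" unfolding dec_enc[OF assms(1,2)] dec_enc[OF assms(1,3)] .
qed simp

lemma gleaf_omega: "gleaf Div Cov (omega :: (nat, nat, 'u) gleaf)"
  unfolding omega_def
proof (rule gleaf_mk_gleaf, goal_cases)
  case (1 d)
  have "sieves d \<subseteq> Pow {e. e dvd d}" by (auto simp: sieves_def)
  then have "finite (sieves d)"
    using finite_divisors[OF 1] by (meson finite_Pow_iff finite_subset)
  then show ?case by (simp add: small_finite[OF inf])
next
  case (2 d c x)
  then obtain S where S: "x = enc S" "S \<in> sieves c" by auto
  then show ?case using sieve_restrict[OF 2(1) S(2)] dec_enc[OF 2(2) S(2)] by simp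
next
  case (3 c x)
  then obtain S where S: "x = enc S" "S \<in> sieves c" by auto
  then have "S \<inter> {e. e dvd c} = S" by (auto simp: sieves_def)
  then show ?case using S dec_enc[OF 3(1) S(2)] by simp
next
  case (4 b d c x)
  then obtain S where S: "x = enc S" "S \<in> sieves c" by auto
  have "d dvd 6" using 4(2,3) by (rule dvd_trans)
  moreover have "S \<inter> {e. e dvd d} \<inter> {e. e dvd b} = S \<inter> {e. e dvd b}"
    using dvd_trans[OF _ 4(1)] by blast
  ultimately show ?case
    using S dec_enc[OF 4(3) S(2)] dec_enc[OF _ sieve_restrict[OF 4(2) S(2)]] by simp
next
  case (5 x y)
  then obtain S T where S: "x = enc S" "S \<in> sieves 2" and T: "y = enc T" "T \<in> sieves 3" by auto
  have dec: "dec (enc S :: 'u) = S" "dec (enc T :: 'u) = T"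
    using dec_enc[OF _ S(2)] dec_enc[OF _ T(2)] by simp_all
  have "S \<inter> {e. e dvd 1} \<in> sieves 1" "T \<inter> {e. e dvd 1} \<in> sieves 1"
    using sieve_restrict[OF _ S(2), of 1] sieve_restrict[OF _ T(2), of 1] by simp_all
  then have eq: "S \<inter> {e. e dvd 1} = T \<inter> {e. e dvd 1}"
    using 5(3) enc_eq_iff[of 1] unfolding S(1) T(1) dec by (simp only: one_dvd)
  note U = sieve_join[OF S(2) T(2)]
  have decU: "dec (enc {d. d dvd 6 \<and> gcd d 2 \<in> S \<and> gcd d 3 \<in> T} :: 'u) =
      {d. d dvd 6 \<and> gcd d 2 \<in> S \<and> gcd d 3 \<in> T}"
    by (rule dec_enc[OF dvd_refl U])
  show ?case
    unfolding S(1) T(1) dec decU sieve_join_restrict[OF S(2) T(2) eq] using U by blast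
qed

lemma FOb_omega: "d dvd 6 \<Longrightarrow> FOb (omega :: (nat, nat, 'u) gleaf) d = enc ` sieves d"
  by (simp add: omega_def)

lemma FMap_omega:
  "d dvd c \<Longrightarrow> c dvd 6 \<Longrightarrow> S \<in> sieves c \<Longrightarrow>
    FMap (omega :: (nat, nat, 'u) gleaf) (arr d c) (enc S) = enc (S \<inter> {e. e dvd d})"
  using dec_enc[of c S] by (simp add: omega_def)

lemma join_omega:
  assumes "S \<in> sieves 2" "T \<in> sieves 3" "1 \<in> S \<longleftrightarrow> 1 \<in> T"
  shows "join omega (enc S) (enc T :: 'u) = enc {d. d dvd 6 \<and> gcd d 2 \<in> S \<and> gcd d 3 \<in> T}"
proof -
  have dec: "dec (enc S :: 'u) = S" "dec (enc T :: 'u) = T"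
    using dec_enc[OF _ assms(1)] dec_enc[OF _ assms(2)] by simp_all
  have "S \<inter> {e. e dvd 1} = T \<inter> {e. e dvd 1}"
    using assms(3) by auto
  then show ?thesis
    unfolding omega_def using assms(1,2) by (subst join_mk_gleaf) (auto simp: dec)
qed

lemma truth_hom: "truth \<in> gleaf_hom Div Cov one (omega :: (nat, nat, 'u) gleaf)"
  unfolding truth_def
proof (rule gleaf_homI[OF gleaf_one[OF inf] gleaf_omega], goal_cases)
  case (1 d x)
  then show ?case using sieve_top by (simp add: FOb_omega)
next
  case (2 d c x)
  have "{e. e dvd c} \<inter> {e. e dvd d} = {e. e dvd d}" using dvd_trans[OF _ 2(1)] by blast
  then show ?case using 2 sieve_top by (simp add: FMap_omega)
next
  case (3 x y)
  have "{d::nat. d dvd 6 \<and> gcd d 2 \<in> {e. e dvd 2} \<and> gcd d 3 \<in> {e. e dvd 3}} = {d. d dvd 6}"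
    by auto
  then show ?case using join_omega[OF sieve_top sieve_top] by simp
qed

text \<open>
  The divisors according to how membership in a glued sieve is decided: by both legs at the top, and
  by one leg below it.
\<close>

lemma divisor_6_cases:
  assumes "e dvd (6::nat)"
  obtains "e = 6" | "e dvd 2" "gcd e 2 = e" "gcd e 3 = 1" | "e dvd 3" "gcd e 3 = e" "gcd e 2 = 1"
proof -
  have "e = 6 \<or> e = 1 \<or> e = 2 \<or> e = 3" using assms unfolding dvd_6_iff by auto
  then show thesis by (elim disjE) (auto intro: that)
qed

context
  fixes F G :: "(nat, nat, 'u) gleaf" and \<mu> :: "nat \<Rightarrow> 'u \<Rightarrow> 'u"
  assumes monic: "monic (Gl Div Cov TYPE('u)) (F, \<mu>, G)"
begin

lemma F_gleaf: "gleaf Div Cov F" and G_gleaf: "gleaf Div Cov G" and mu_hom: "\<mu> \<in> gleaf_hom Div Cov F G"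
  using monic by (auto simp: monic_def Gl_simps)

lemma mu_inj: "d dvd 6 \<Longrightarrow> x \<in> FOb F d \<Longrightarrow> y \<in> FOb F d \<Longrightarrow> \<mu> d x = \<mu> d y \<longleftrightarrow> x = y"
  using monic_Gl_inj[OF inf monic] by blast

lemma image_res:
  assumes "e dvd d" "d dvd 6" "y \<in> \<mu> d ` FOb F d"
  shows "FMap G (arr e d) y \<in> \<mu> e ` FOb F e"
proof -
  obtain x where x: "x \<in> FOb F d" "y = \<mu> d x" using assms(3) by blast
  then show ?thesis
    using gleaf_hom_natural[OF mu_hom assms(1,2) x(1)] res_mem[OF F_gleaf assms(1,2) x(1)] by (metis imageI)
qed

text \<open>
  The characteristic map respects glueing for this reason. In the backward direction, injectivity
  of \<open>\<mu>\<close> ensures that the preimages of a matching pair match.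
\<close>

lemma image_join:
  assumes "y \<in> FOb G 2" "z \<in> FOb G 3" "FMap G (arr 1 2) y = FMap G (arr 1 3) z"
  shows "join G y z \<in> \<mu> 6 ` FOb F 6 \<longleftrightarrow> y \<in> \<mu> 2 ` FOb F 2 \<and> z \<in> \<mu> 3 ` FOb F 3"
proof
  assume "join G y z \<in> \<mu> 6 ` FOb F 6"
  then show "y \<in> \<mu> 2 ` FOb F 2 \<and> z \<in> \<mu> 3 ` FOb F 3"
    using image_res[of 2 6 "join G y z"] image_res[of 3 6 "join G y z"]
      join_left[OF G_gleaf assms] join_right[OF G_gleaf assms] by simp
next
  assume "y \<in> \<mu> 2 ` FOb F 2 \<and> z \<in> \<mu> 3 ` FOb F 3"
  then obtain x x' where x: "x \<in> FOb F 2" "y = \<mu> 2 x" and x': "x' \<in> FOb F 3" "z = \<mu> 3 x'" by auto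
  have "\<mu> 1 (FMap F (arr 1 2) x) = \<mu> 1 (FMap F (arr 1 3) x')"
    using assms(3) gleaf_hom_natural[OF mu_hom, of 1 2 x] gleaf_hom_natural[OF mu_hom, of 1 3 x'] x x' by simp
  then have eq: "FMap F (arr 1 2) x = FMap F (arr 1 3) x'"
    using mu_inj[of 1] res_mem[OF F_gleaf, of 1 2 x] res_mem[OF F_gleaf, of 1 3 x'] x x' by simp
  have "join G y z = \<mu> 6 (join F x x')"
    using gleaf_hom_join[OF F_gleaf mu_hom x(1) x'(1) eq] x x' by simp
  then show "join G y z \<in> \<mu> 6 ` FOb F 6"
    using join_mem[OF F_gleaf x(1) x'(1) eq] by blast
qed

lemma char_sieve:
  assumes "d dvd 6" "y \<in> FOb G d"
  shows "{e. e dvd d \<and> FMap G (arr e d) y \<in> \<mu> e ` FOb F e} \<in> sieves d"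
proof -
  have "b dvd d \<and> FMap G (arr b d) y \<in> \<mu> b ` FOb F b"
    if "e dvd d" "FMap G (arr e d) y \<in> \<mu> e ` FOb F e" "b dvd e" for b e
    using image_res[OF that(3) dvd_trans[OF that(1) assms(1)] that(2)]
      res_comp[OF G_gleaf that(3,1) assms] dvd_trans[OF that(3,1)] by simp
  then show ?thesis unfolding sieves_def by blast
qed

lemma char_map_hom: "char_map F \<mu> G \<in> gleaf_hom Div Cov G omega"
  unfolding char_map_def
proof (rule gleaf_homI[OF G_gleaf gleaf_omega], goal_cases)
  case (1 d y)
  then show ?case using char_sieve by (auto simp: FOb_omega)
next
  case (2 d c y)
  have "{e. e dvd c \<and> FMap G (arr e c) y \<in> \<mu> e ` FOb F e} \<inter> {e. e dvd d} =
      {e. e dvd d \<and> FMap G (arr e d) (FMap G (arr d c) y) \<in> \<mu> e ` FOb F e}"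
    using res_comp[OF G_gleaf _ 2] dvd_trans[OF _ 2(1)] by auto
  then show ?case using 2 FMap_omega[OF 2(1,2) char_sieve[OF 2(2,3)]] by simp
next
  case (3 y z)
  let ?S = "\<lambda>d y. {e. e dvd d \<and> FMap G (arr e d) y \<in> \<mu> e ` FOb F e}"
  note j = join_mem[OF G_gleaf 3] join_left[OF G_gleaf 3] join_right[OF G_gleaf 3]
  have S: "?S 2 y \<in> sieves 2" "?S 3 z \<in> sieves 3"
    using char_sieve 3 by auto
  have 1: "1 \<in> ?S 2 y \<longleftrightarrow> 1 \<in> ?S 3 z" using 3(3) by simp
  have eq: "?S 6 (join G y z) = {d. d dvd 6 \<and> gcd d 2 \<in> ?S 2 y \<and> gcd d 3 \<in> ?S 3 z}"
  proof (intro Collect_cong conj_cong refl)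
    fix e :: nat assume e: "e dvd 6"
    have below2: "FMap G (arr e 6) (join G y z) = FMap G (arr e 2) y" if "e dvd 2"
      using res_comp[OF G_gleaf that _ _ j(1)] j(2) by simp
    have below3: "FMap G (arr e 6) (join G y z) = FMap G (arr e 3) z" if "e dvd 3"
      using res_comp[OF G_gleaf that _ _ j(1)] j(3) by simp
    from e show "FMap G (arr e 6) (join G y z) \<in> \<mu> e ` FOb F e \<longleftrightarrow>
        gcd e 2 \<in> ?S 2 y \<and> gcd e 3 \<in> ?S 3 z"
    proof (cases rule: divisor_6_cases)
      case 1
      have "gcd 6 2 = (2::nat)" "gcd 6 3 = (3::nat)" by simp_all
      then show ?thesis
        using 1 image_join[OF 3] j(1) 3(1,2) res_id[OF G_gleaf] by simp
    next
      case 2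
      have "1 \<in> ?S 2 y" if "e \<in> ?S 2 y" using sieve_down[OF S(1) that] by simp
      then show ?thesis using 2 below2 1 by simp blast
    next
      case 3
      have "1 \<in> ?S 3 z" if "e \<in> ?S 3 z" using sieve_down[OF S(2) that] by simp
      then show ?thesis using 3 below3 1 by simp blast
    qed
  qed
  show ?case using join_omega[OF S 1] unfolding eq by simp
qed

text \<open>
  As \<open>\<mu>\<close> is injective, preimages under it inherit naturality and compatibility with glueing from \<open>\<rho>\<close>.
\<close>

lemma lift_through_monic:
  assumes T: "gleaf Div Cov T" and \<rho>: "\<rho> \<in> gleaf_hom Div Cov T G"
    and im: "\<And>d t. d dvd 6 \<Longrightarrow> t \<in> FOb T d \<Longrightarrow> \<rho> d t \<in> \<mu> d ` FOb F d"
  obtains \<upsilon> where "\<upsilon> \<in> gleaf_hom Div Cov T F"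
    "\<And>d t. d dvd 6 \<Longrightarrow> t \<in> FOb T d \<Longrightarrow> \<mu> d (\<upsilon> d t) = \<rho> d t"
proof -
  define h where "h d t = inv_into (FOb F d) (\<mu> d) (\<rho> d t)" for d t
  have h: "h d t \<in> FOb F d" "\<mu> d (h d t) = \<rho> d t" if "d dvd 6" "t \<in> FOb T d" for d t
    using im[OF that] unfolding h_def by (auto intro: inv_into_into f_inv_into_f)
  have "(\<lambda>d\<in>Ob Div. \<lambda>t\<in>FOb T d. h d t) \<in> gleaf_hom Div Cov T F"
  proof (rule gleaf_homI[OF T F_gleaf h(1)])
    fix d c t assume dc: "d dvd c" "c dvd 6" and t: "t \<in> FOb T c"
    have d: "d dvd 6" using dc by (rule dvd_trans)
    have t': "FMap T (arr d c) t \<in> FOb T d" by (rule res_mem[OF T dc t])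
    have "\<mu> d (h d (FMap T (arr d c) t)) = \<mu> d (FMap F (arr d c) (h c t))"
      using h(2)[OF d t'] h[OF dc(2) t] gleaf_hom_natural[OF \<rho> dc t]
        gleaf_hom_natural[OF mu_hom dc h(1)[OF dc(2) t]] by simp
    then show "h d (FMap T (arr d c) t) = FMap F (arr d c) (h c t)"
      using mu_inj[OF d h(1)[OF d t'] res_mem[OF F_gleaf dc h(1)[OF dc(2) t]]] by simp
  next
    fix s t assume s: "s \<in> FOb T 2" and t: "t \<in> FOb T 3"
      and st: "FMap T (arr 1 2) s = FMap T (arr 1 3) t"
    have 6: "2 dvd (6::nat)" "3 dvd (6::nat)" by simp_all
    have hs: "h 2 s \<in> FOb F 2" "h 3 t \<in> FOb F 3" "\<mu> 2 (h 2 s) = \<rho> 2 s" "\<mu> 3 (h 3 t) = \<rho> 3 t"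
      using h s t by simp_all
    have "\<mu> 1 (FMap F (arr 1 2) (h 2 s)) = \<mu> 1 (FMap F (arr 1 3) (h 3 t))"
      using gleaf_hom_natural[OF mu_hom _ _ hs(1), of 1] gleaf_hom_natural[OF mu_hom _ _ hs(2), of 1]
        gleaf_hom_natural[OF \<rho> _ _ s, of 1] gleaf_hom_natural[OF \<rho> _ _ t, of 1] st hs by simp
    then have eq: "FMap F (arr 1 2) (h 2 s) = FMap F (arr 1 3) (h 3 t)"
      using mu_inj[of 1] res_mem[OF F_gleaf _ _ hs(1), of 1] res_mem[OF F_gleaf _ _ hs(2), of 1] by simp
    note j = join_mem[OF T s t st]
    have "\<mu> 6 (h 6 (join T s t)) = \<mu> 6 (join F (h 2 s) (h 3 t))"
      using h(2)[OF _ j] gleaf_hom_join[OF T \<rho> s t st] gleaf_hom_join[OF F_gleaf mu_hom hs(1,2) eq] hs by simp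
    then show "h 6 (join T s t) = join F (h 2 s) (h 3 t)"
      using mu_inj[OF _ h(1)[OF _ j] join_mem[OF F_gleaf hs(1,2) eq]] by simp
  qed
  then show thesis using h by (intro that) auto
qed

lemma char_map_pullback:
  "is_pullback (Gl Div Cov TYPE('u)) (G, char_map F \<mu> G, omega) (one, truth, omega)
     (F, \<mu>, G) (F, collapse F, one)" (is "is_pullback ?G ?\<chi> ?tr ?m ?k")
  unfolding is_pullback_def
proof (intro conjI ballI impI)
  show "?\<chi> \<in> Arr ?G" using G_gleaf gleaf_omega char_map_hom by (simp add: Gl_simps)
  show "?tr \<in> Arr ?G" using gleaf_one[OF inf] gleaf_omega truth_hom by (simp add: Gl_simps)
  show "Cod ?G ?\<chi> = Cod ?G ?tr" by (simp add: Gl_simps)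
  show "?m \<in> hom ?G (Dom ?G ?m) (Dom ?G ?\<chi>)" using F_gleaf G_gleaf mu_hom by (simp add: Gl_simps)
  show "?k \<in> hom ?G (Dom ?G ?m) (Dom ?G ?tr)"
    using F_gleaf gleaf_one[OF inf] collapse_one[OF inf F_gleaf] by (simp add: Gl_simps)
  have "char_map F \<mu> G d (\<mu> d x) = truth d (collapse F d x)" if d: "d dvd 6" and x: "x \<in> FOb F d" for d x
  proof -
    have "{e. e dvd d \<and> FMap G (arr e d) (\<mu> d x) \<in> \<mu> e ` FOb F e} = {e. e dvd d}"
      using image_res[OF _ d] x by auto
    then show ?thesis
      using d x gleaf_hom_mem[OF mu_hom d x] by (simp add: char_map_def truth_def collapse_def one_def)
  qed
  then show "Comp ?G ?\<chi> ?m = Comp ?G ?tr ?k"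
    unfolding Gl_Comp_eq_iff by blast
  fix T r s assume "T \<in> Ob ?G" and r: "r \<in> hom ?G T (Dom ?G ?\<chi>)" and s: "s \<in> hom ?G T (Dom ?G ?tr)"
    and eq: "Comp ?G ?\<chi> r = Comp ?G ?tr s"
  then have T: "gleaf Div Cov T" by (simp add: Gl_simps)
  obtain \<rho> \<sigma> where rs: "r = (T, \<rho>, G)" "s = (T, \<sigma>, one)"
    "\<rho> \<in> gleaf_hom Div Cov T G" "\<sigma> \<in> gleaf_hom Div Cov T one"
    using r s by (auto simp: hom_Gl Gl_simps)
  have im: "\<rho> d t \<in> \<mu> d ` FOb F d" if d: "d dvd 6" and t: "t \<in> FOb T d" for d t
  proof -
    have y: "\<rho> d t \<in> FOb G d" by (rule gleaf_hom_mem[OF rs(3) d t])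
    have "char_map F \<mu> G d (\<rho> d t) = truth d (\<sigma> d t)"
      using eq d t unfolding rs(1,2) Gl_Comp_eq_iff by blast
    then have "enc {e. e dvd d \<and> FMap G (arr e d) (\<rho> d t) \<in> \<mu> e ` FOb F e} = (enc {e. e dvd d} :: 'u)"
      using d y gleaf_hom_mem[OF rs(4) d t] by (simp add: char_map_def truth_def)
    then have "{e. e dvd d \<and> FMap G (arr e d) (\<rho> d t) \<in> \<mu> e ` FOb F e} = {e. e dvd d}"
      using enc_eq_iff[OF d char_sieve[OF d y] sieve_top] by simp
    then have "d \<in> {e. e dvd d \<and> FMap G (arr e d) (\<rho> d t) \<in> \<mu> e ` FOb F e}" by simp
    then have "FMap G (arr d d) (\<rho> d t) \<in> \<mu> d ` FOb F d" by simp
    then show ?thesis using res_id[OF G_gleaf d y] by simp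
  qed
  obtain \<upsilon> where \<upsilon>: "\<upsilon> \<in> gleaf_hom Div Cov T F"
    "\<And>d t. d dvd 6 \<Longrightarrow> t \<in> FOb T d \<Longrightarrow> \<mu> d (\<upsilon> d t) = \<rho> d t"
    using lift_through_monic[OF T rs(3) im] by blast
  interpret category ?G by (rule category_Gl)
  let ?u = "(T, \<upsilon>, F)"
  have u: "?u \<in> hom ?G T F" using T F_gleaf \<upsilon>(1) by (simp add: Gl_simps)
  have mu: "Comp ?G ?m ?u = r"
  proof -
    have "(\<lambda>c\<in>Ob Div. \<lambda>x\<in>FOb T c. \<mu> c (\<upsilon> c x)) = \<rho>"
      by (rule gleaf_hom_eqI[OF gleaf_hom_Comp[OF T \<upsilon>(1) mu_hom] rs(3)]) (simp add: \<upsilon>(2))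
    then show ?thesis by (simp add: rs Gl_simps)
  qed
  have k: "?k \<in> hom ?G F one"
    using F_gleaf gleaf_one[OF inf] collapse_one[OF inf F_gleaf] by (simp add: Gl_simps)
  have ku: "Comp ?G ?k ?u = s"
    using terminal_one[OF inf] \<open>T \<in> Ob ?G\<close> Comp_hom[OF u k] s
    unfolding is_terminal_def Gl_simps(2) by blast
  have "v = ?u" if "v \<in> hom ?G T F" "Comp ?G ?m v = r" for v
    using monic that u mu \<open>T \<in> Ob ?G\<close> unfolding monic_def Gl_simps(2) by metis
  then show "\<exists>!u. u \<in> hom ?G T (Dom ?G ?m) \<and> Comp ?G ?m u = r \<and> Comp ?G ?k u = s"
    using u mu ku unfolding Gl_simps(2) by blast
qed

text \<open>
  If the square is a pullback, then \<open>\<chi> w\<close> is the maximal sieve exactly for the \<open>w\<close> in the image of \<open>\<mu>\<close>, as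
  one sees by testing with the free gleaf on \<open>w\<close>. By naturality, \<open>\<chi>\<close> is then determined everywhere:
  a sieve contains \<open>e\<close> iff its restriction to \<open>e\<close> is maximal.
\<close>

lemma char_map_unique:
  assumes \<chi>: "\<chi> \<in> gleaf_hom Div Cov G omega"
    and pb: "is_pullback (Gl Div Cov TYPE('u)) (G, \<chi>, omega) (one, truth, omega) (F, \<mu>, G) k"
  shows "\<chi> = char_map F \<mu> G"
proof (rule gleaf_hom_eqI[OF \<chi> char_map_hom])
  let ?G = "Gl Div Cov TYPE('u)"
  obtain \<kappa> where k: "k = (F, \<kappa>, one)" "\<kappa> \<in> gleaf_hom Div Cov F one"
    using pb unfolding is_pullback_def Gl_simps(2) by (auto simp: hom_Gl)
  have comm: "\<chi> d (\<mu> d x) = truth d (\<kappa> d x)" if "d dvd 6" "x \<in> FOb F d" for d x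
    using pb that unfolding is_pullback_def k(1) Gl_Comp_eq_iff by blast
  have true_iff: "\<chi> e w = enc {b. b dvd e} \<longleftrightarrow> w \<in> \<mu> e ` FOb F e"
    if e: "e dvd 6" and w: "w \<in> FOb G e" for e w
  proof
    assume "w \<in> \<mu> e ` FOb F e"
    then show "\<chi> e w = enc {b. b dvd e}"
      using comm[OF e] gleaf_hom_mem[OF k(2) e] e by (auto simp: truth_def)
  next
    assume max: "\<chi> e w = enc {b. b dvd e}"
    let ?r = "(free e, yoneda G e w, G)" and ?s = "(free e, collapse (free e), one)"
    note Fe = gleaf_free[OF inf e]
    note yw = yoneda_hom[OF inf G_gleaf e w] and col = collapse_one[OF inf Fe]
    have r: "?r \<in> hom ?G (free e) G" and s: "?s \<in> hom ?G (free e) one"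
      using Fe G_gleaf yw col gleaf_one[OF inf] by (simp_all add: Gl_simps)
    have gen: "(gen e :: 'u) \<in> FOb (free e) e" by (rule gen_in_free[OF inf e])
    have "(\<lambda>c\<in>Ob Div. \<lambda>x\<in>FOb (free e) c. \<chi> c (yoneda G e w c x)) e (gen e) = enc {b. b dvd e}"
      using e gen yoneda_gen[OF inf G_gleaf e w] max by simp
    moreover have "(\<lambda>c\<in>Ob Div. \<lambda>x\<in>FOb (free e) c. truth c (collapse (free e) c x)) e (gen e) =
        (enc {b. b dvd e} :: 'u)"
      using e gen by (simp add: truth_def collapse_def one_def)
    ultimately have "(\<lambda>c\<in>Ob Div. \<lambda>x\<in>FOb (free e) c. \<chi> c (yoneda G e w c x)) =
        (\<lambda>c\<in>Ob Div. \<lambda>x\<in>FOb (free e) c. truth c (collapse (free e) c x))"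
      by (subst yoneda_unique[OF inf gleaf_omega e gleaf_hom_Comp[OF Fe yw \<chi>]],
          subst yoneda_unique[OF inf gleaf_omega e gleaf_hom_Comp[OF Fe col truth_hom]]) simp
    then have "Comp ?G (G, \<chi>, omega) ?r = Comp ?G (one, truth, omega) ?s"
      by (simp add: Gl_simps)
    moreover have "free e \<in> Ob ?G" using Fe by (simp add: Gl_simps)
    ultimately obtain u where u: "u \<in> hom ?G (free e) F" "Comp ?G (F, \<mu>, G) u = ?r"
      using pb r s unfolding is_pullback_def Gl_simps(2) by blast
    then obtain \<upsilon> where \<upsilon>: "u = (free e, \<upsilon>, F)" "\<upsilon> \<in> gleaf_hom Div Cov (free e) F"
      by (auto simp: hom_Gl)
    have "(\<lambda>c\<in>Ob Div. \<lambda>x\<in>FOb (free e) c. \<mu> c (\<upsilon> c x)) e (gen e) = yoneda G e w e (gen e)"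
      using u(2) unfolding \<upsilon>(1) by (simp add: Gl_simps)
    then have "w = \<mu> e (\<upsilon> e (gen e))"
      using yoneda_gen[OF inf G_gleaf e w] e gen by simp
    then show "w \<in> \<mu> e ` FOb F e"
      using gleaf_hom_mem[OF \<upsilon>(2) e gen] by blast
  qed
  fix d y assume d: "d dvd 6" and y: "y \<in> FOb G d"
  obtain S where S: "\<chi> d y = enc S" "S \<in> sieves d"
    using gleaf_hom_mem[OF \<chi> d y] by (auto simp: FOb_omega[OF d])
  have "e \<in> S \<longleftrightarrow> FMap G (arr e d) y \<in> \<mu> e ` FOb F e" if e: "e dvd d" for e
  proof -
    have e6: "e dvd 6" using e d by (rule dvd_trans)
    have "\<chi> e (FMap G (arr e d) y) = enc (S \<inter> {b. b dvd e})"
      using gleaf_hom_natural[OF \<chi> e d y] FMap_omega[OF e d S(2)] S(1) by simp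
    then have "FMap G (arr e d) y \<in> \<mu> e ` FOb F e \<longleftrightarrow> S \<inter> {b. b dvd e} = {b. b dvd e}"
      using true_iff[OF e6 res_mem[OF G_gleaf e d y]]
        enc_eq_iff[OF e6 sieve_restrict[OF e S(2)] sieve_top] by simp
    also have "\<dots> \<longleftrightarrow> e \<in> S" using S(2) by (auto simp: sieves_def)
    finally show ?thesis by simp
  qed
  then have "S = {e. e dvd d \<and> FMap G (arr e d) y \<in> \<mu> e ` FOb F e}"
    using S(2) by (auto simp: sieves_def)
  then show "\<chi> d y = char_map F \<mu> G d y"
    using S(1) d y by (simp add: char_map_def)
qed

end

lemma subobject_classifier_omega:
  "is_subobject_classifier (Gl Div Cov TYPE('u)) one omega (one, truth, omega)"
  unfolding is_subobject_classifier_def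
proof (intro conjI allI impI)
  let ?G = "Gl Div Cov TYPE('u)"
  show "is_terminal ?G one" by (rule terminal_one[OF inf])
  show "omega \<in> Ob ?G" using gleaf_omega by (simp add: Gl_simps)
  show "(one, truth, omega) \<in> hom ?G one omega"
    using gleaf_one[OF inf] gleaf_omega truth_hom by (simp add: Gl_simps)
  fix m assume m: "monic ?G m"
  obtain F \<mu> G where mF: "m = (F, \<mu>, G)" by (cases m)
  note monic = m[unfolded mF]
  show "\<exists>!\<chi>. \<chi> \<in> hom ?G (Cod ?G m) omega \<and> (\<exists>k. is_pullback ?G \<chi> (one, truth, omega) m k)"
  proof (rule ex1I[of _ "(G, char_map F \<mu> G, omega)"])
    show "(G, char_map F \<mu> G, omega) \<in> hom ?G (Cod ?G m) omega \<and>
        (\<exists>k. is_pullback ?G (G, char_map F \<mu> G, omega) (one, truth, omega) m k)"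
      using char_map_pullback[OF monic] char_map_hom[OF monic] G_gleaf[OF monic] gleaf_omega
      by (auto simp: mF Gl_simps)
  next
    fix \<chi> assume \<chi>: "\<chi> \<in> hom ?G (Cod ?G m) omega \<and> (\<exists>k. is_pullback ?G \<chi> (one, truth, omega) m k)"
    then obtain \<theta> where "\<chi> = (G, \<theta>, omega)" "\<theta> \<in> gleaf_hom Div Cov G omega"
      by (auto simp: mF Gl_simps hom_Gl)
    then show "\<chi> = (G, char_map F \<mu> G, omega)"
      using \<chi> char_map_unique[OF monic] by (auto simp: mF)
  qed
qed

end

theorem theorem4p4p2:
  assumes "universe TYPE('u)"
  shows "\<exists>(C :: (nat, nat) cat) B. bicovering_system C B \<and>
           \<not> cartesian_closed (Gl C B TYPE('u)) \<and>
           has_subobject_classifier (Gl C B TYPE('u))"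
proof -
  have inf: "infinite (UNIV :: 'u set)"
    using assms by (simp add: universe_def)
  show ?thesis
    using bicovering_system_Div not_cartesian_closed[OF inf] subobject_classifier_omega[OF inf]
    unfolding has_subobject_classifier_def by blast
qed

end
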